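(* Let $\mathscr{X}$ be a finitely well-complete closed symmetric monoidal category, $\mathbb{L}$ a commutative $\mathscr{X}$-monad on $\underline{\mathscr{X}}$ with tensor products of algebras, $\mathscr{L}=\mathscr{X}^{\mathbb{L}}$, and $\widetilde{\mathbb{D}}$ the accessible distribution monad. A $\widetilde{\mathbb{D}}$-algebra $(X,a)$ is Pettis if and only if its underlying linear space $E$ is separated. In particular, the underlying linear space of a $\widetilde{\mathbb{D}}$-algebra is $\widetilde{\mathbb{D}}$-Pettis as soon as it is separated.
   Context: Standing data. $\mathscr{X}=(\mathscr{X},\boxtimes,I)$ is a closed symmetric monoidal category that is finitely well-complete (it has finite limits and intersections, i.e. fibre products, of arbitrary class-indexed families of strong monomorphisms with common codomain); $\underline{\mathscr{X}}$ is $\mathscr{X}$ enriched in itself. $\mathbb{L}=(L,\eta,\mu^{\mathbb{L}})$ is an $\mathscr{X}$-monad on $\underline{\mathscr{X}}$ that is commutative: with $t'_{XY}:LX\boxtimes Y\to L(X\boxtimes Y)$, $t''_{XY}:X\boxtimes LY\to L(X\boxtimes Y)$ the strengths (transposes of $Y\to\underline{\mathscr{X}}(X,X\boxtimes Y)\xrightarrow{L}\underline{\mathscr{X}}(LX,L(X\boxtimes Y))$ and $X\to\underline{\mathscr{X}}(Y,X\boxtimes Y)\xrightarrow{L}\underline{\mathscr{X}}(LY,L(X\boxtimes Y))$), the morphisms $\otimes_{XY}=\mu^{\mathbb{L}}\cdot Lt'_{XY}\cdot t''_{LX,Y}$ and $\mu^{\mathbb{L}}\cdot Lt''_{XY}\cdot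 t'_{X,LY}$ coincide. It has tensor products of algebras: for all algebras $(X,a),(Y,b)$ the pair $\mu^{\mathbb{L}}\cdot L\otimes_{XY},\ L(a\boxtimes b):(L(LX\boxtimes LY),\mu^{\mathbb{L}})\rightrightarrows(L(X\boxtimes Y),\mu^{\mathbb{L}})$ has a coequalizer in $\mathscr{X}^{\mathbb{L}}$. $\mathscr{L}:=\mathscr{X}^{\mathbb{L}}$, with Eilenberg–Moore $\mathscr{X}$-adjunction $F\dashv G:\mathscr{L}\to\underline{\mathscr{X}}$ (unit $\eta$, counit $\varepsilon$). $\mathscr{L}$ is closed symmetric monoidal (tensor product: for algebras $A=(X,a)$, $B=(Y,b)$, $A\otimes B$ is the coequalizer in $\mathscr{X}^{\mathbb{L}}$ of the pair $\mu^{\mathbb{L}}\cdot L\otimes_{XY},\ L(a\boxtimes b):(L(LX\boxtimes LY),\mu^{\mathbb{L}})\rightrightarrows(L(X\boxtimes Y),\mu^{\mathbb{L}})$; unit object $R:=FI$; internal hom $\underline{\mathscr{L}}(A,B)$ with $G\underline{\mathscr{L}}(A,B)=\mathscr{L}(A,B)$, the hom-object of the Eilenberg–Moore $\mathscr{X}$-category); $\underline{\mathscr{L}}$ is $\mathscr{L}$ enriched in itself. Objects of $\mathscr{L}$ are called linear spaces. Duality. $E^*:=\underline{\mathscr{L}}(E,R)$; $\mathbb{H}=(H,\mathfrak{d},\mathfrak{k})$ is the double-dualization monad induced by $\underline{\mathscr{L}}(-,R)\dashv\underline{\mathscr{L}}(-,R):\underline{\mathscr{L}}^{\mathrm{op}}\to\underline{\mathscr{L}}$,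 so $HE=E^{**}$. $E$ is separated if $\mathfrak{d}_E:E\to E^{**}$ is a strong monomorphism in $\mathscr{L}$. Accessible distributions. $E$ is functionally complete if $\underline{\mathscr{L}}(h,E)$ is an isomorphism for every $h$ in $\mathscr{L}$ with $h^{**}$ an isomorphism. The functionally complete objects form an $\mathscr{L}$-reflective subcategory of $\underline{\mathscr{L}}$, with idempotent $\mathscr{L}$-monad $\widetilde{\mathbb{H}}=(\widetilde{H},\widetilde{\mathfrak{d}},\widetilde{\mathfrak{k}})$; $i:\widetilde{\mathbb{H}}\to\mathbb{H}$ is the unique monad morphism ($i_E\cdot\widetilde{\mathfrak{d}}_E=\mathfrak{d}_E$). The accessible distribution monad $\widetilde{\mathbb{D}}$ on $\underline{\mathscr{X}}$ has $\widetilde{D}=G\widetilde{H}F$, unit $(G\widetilde{\mathfrak{d}}F)\cdot\eta$, multiplication $(G\widetilde{\mathfrak{k}}F)\cdot(G\widetilde{H}\varepsilon\widetilde{H}F)$. Let $\widetilde{\xi}_E:=Gi_E\cdot G\widetilde{H}\varepsilon_E:\widetilde{D}GE\to GHE$, and let $\widetilde{\Delta}:=G\widetilde{\mathfrak{d}}F:L\to\widetilde{D}$, a morphism of $\mathscr{X}$-monads $\mathbb{L}\to\widetilde{\mathbb{D}}$. The underlying linear space of a $\widetilde{\mathbb{D}}$-algebra $(X,a)$ is the $\mathbb{L}$-algebra $(X,a\cdot\widetilde{\Delta}_X)$. A linear space $E$ is $\widetilde{\mathbb{D}}$-Pettis if $E$ is separated and there is a (necessarily unique) morphism $a_E:\widetilde{D}GE\to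 GE$ in $\mathscr{X}$ with $G\mathfrak{d}_E\cdot a_E=\widetilde{\xi}_E$; then $(GE,a_E)$ is a $\widetilde{\mathbb{D}}$-algebra. A $\widetilde{\mathbb{D}}$-algebra is Pettis if it equals $(GE,a_E)$ for some $\widetilde{\mathbb{D}}$-Pettis linear space $E$. *)

theory Defs
  imports Main
begin

section \<open>Categories\<close>

text \<open>
  \<open>Comp C g f\<close> is \<open>g\<close> after \<open>f\<close>.  The values of all operations are meaningful only on objects and
  on (composable) arrows in the carriers.
\<close>

record ('o, 'm) category =
  Obj :: "'o set"
  Arr :: "'m set"
  Dom :: "'m \<Rightarrow> 'o"
  Cod :: "'m \<Rightarrow> 'o"
  Id :: "'o \<Rightarrow> 'm"
  Comp :: "'m \<Rightarrow> 'm \<Rightarrow> 'm"  (infixr \<open>\<cdot>\<index>\<close> 70)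

definition hom :: "('o, 'm, 'x) category_scheme \<Rightarrow> 'o \<Rightarrow> 'o \<Rightarrow> 'm set" where
  "hom C A B = {f \<in> Arr C. Dom C f = A \<and> Cod C f = B}"

locale category =
  fixes C :: "('o, 'm, 'x) category_scheme" (structure)
  assumes Dom_in: "f \<in> Arr C \<Longrightarrow> Dom C f \<in> Obj C"
    and Cod_in: "f \<in> Arr C \<Longrightarrow> Cod C f \<in> Obj C"
    and Id_in: "A \<in> Obj C \<Longrightarrow> Id C A \<in> hom C A A"
    and Comp_in: "f \<in> hom C A B \<Longrightarrow> g \<in> hom C B D \<Longrightarrow> g \<cdot> f \<in> hom C A D"
    and Comp_Id: "f \<in> hom C A B \<Longrightarrow> f \<cdot> Id C A = f"
    and Id_Comp: "f \<in> hom C A B \<Longrightarrow> Id C B \<cdot> f = f"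
    and Comp_assoc: "f \<in> hom C A B \<Longrightarrow> g \<in> hom C B D \<Longrightarrow> h \<in> hom C D E
                      \<Longrightarrow> (h \<cdot> g) \<cdot> f = h \<cdot> (g \<cdot> f)"

definition iso_arr :: "('o, 'm, 'x) category_scheme \<Rightarrow> 'm \<Rightarrow> bool" where
  "iso_arr C f \<longleftrightarrow> f \<in> Arr C \<and>
     (\<exists>g\<in>hom C (Cod C f) (Dom C f).
        g \<cdot>\<^bsub>C\<^esub> f = Id C (Dom C f) \<and> f \<cdot>\<^bsub>C\<^esub> g = Id C (Cod C f))"

definition monic :: "('o, 'm, 'x) category_scheme \<Rightarrow> 'm \<Rightarrow> bool" where
  "monic C m \<longleftrightarrow> m \<in> Arr C \<and>
     (\<forall>Z\<in>Obj C. \<forall>f\<in>hom C Z (Dom C m). \<forall>g\<in>hom C Z (Dom C m).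
        m \<cdot>\<^bsub>C\<^esub> f = m \<cdot>\<^bsub>C\<^esub> g \<longrightarrow> f = g)"

definition epic :: "('o, 'm, 'x) category_scheme \<Rightarrow> 'm \<Rightarrow> bool" where
  "epic C e \<longleftrightarrow> e \<in> Arr C \<and>
     (\<forall>Z\<in>Obj C. \<forall>f\<in>hom C (Cod C e) Z. \<forall>g\<in>hom C (Cod C e) Z.
        f \<cdot>\<^bsub>C\<^esub> e = g \<cdot>\<^bsub>C\<^esub> e \<longrightarrow> f = g)"

definition orthogonal :: "('o, 'm, 'x) category_scheme \<Rightarrow> 'm \<Rightarrow> 'm \<Rightarrow> bool" where
  "orthogonal C e m \<longleftrightarrow>
     (\<forall>u\<in>hom C (Dom C e) (Dom C m). \<forall>v\<in>hom C (Cod C e) (Cod C m).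
        m \<cdot>\<^bsub>C\<^esub> u = v \<cdot>\<^bsub>C\<^esub> e \<longrightarrow>
        (\<exists>!w. w \<in> hom C (Cod C e) (Dom C m) \<and> w \<cdot>\<^bsub>C\<^esub> e = u \<and> m \<cdot>\<^bsub>C\<^esub> w = v))"

definition strong_mono :: "('o, 'm, 'x) category_scheme \<Rightarrow> 'm \<Rightarrow> bool" where
  "strong_mono C m \<longleftrightarrow> monic C m \<and> (\<forall>e. epic C e \<longrightarrow> orthogonal C e m)"

definition is_equalizer ::
  "('o, 'm, 'x) category_scheme \<Rightarrow> 'm \<Rightarrow> 'm \<Rightarrow> 'm \<Rightarrow> bool" where
  "is_equalizer C f g u \<longleftrightarrow> u \<in> Arr C \<and> Cod C u = Dom C f \<and> f \<cdot>\<^bsub>C\<^esub> u = g \<cdot>\<^bsub>C\<^esub> u \<and>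
     (\<forall>Z\<in>Obj C. \<forall>z\<in>hom C Z (Dom C f). f \<cdot>\<^bsub>C\<^esub> z = g \<cdot>\<^bsub>C\<^esub> z \<longrightarrow>
        (\<exists>!t. t \<in> hom C Z (Dom C u) \<and> u \<cdot>\<^bsub>C\<^esub> t = z))"

definition is_coequalizer ::
  "('o, 'm, 'x) category_scheme \<Rightarrow> 'm \<Rightarrow> 'm \<Rightarrow> 'm \<Rightarrow> bool" where
  "is_coequalizer C f g q \<longleftrightarrow> q \<in> Arr C \<and> Dom C q = Cod C f \<and> q \<cdot>\<^bsub>C\<^esub> f = q \<cdot>\<^bsub>C\<^esub> g \<and>
     (\<forall>Z\<in>Obj C. \<forall>z\<in>hom C (Cod C f) Z. z \<cdot>\<^bsub>C\<^esub> f = z \<cdot>\<^bsub>C\<^esub> g \<longrightarrow>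
        (\<exists>!t. t \<in> hom C (Cod C q) Z \<and> t \<cdot>\<^bsub>C\<^esub> q = z))"

definition is_functor ::
  "('p, 'n, 'y) category_scheme \<Rightarrow> ('o, 'm, 'x) category_scheme \<Rightarrow>
     ('p \<Rightarrow> 'o) \<Rightarrow> ('n \<Rightarrow> 'm) \<Rightarrow> bool" where
  "is_functor J C Fo Fa \<longleftrightarrow>
     (\<forall>j\<in>Obj J. Fo j \<in> Obj C \<and> Fa (Id J j) = Id C (Fo j)) \<and>
     (\<forall>f\<in>Arr J. Fa f \<in> hom C (Fo (Dom J f)) (Fo (Cod J f))) \<and>
     (\<forall>f\<in>Arr J. \<forall>g\<in>Arr J. Dom J g = Cod J f \<longrightarrow> Fa (g \<cdot>\<^bsub>J\<^esub> f) = Fa g \<cdot>\<^bsub>C\<^esub> Fa f)"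

definition is_cone ::
  "('p, 'n, 'y) category_scheme \<Rightarrow> ('o, 'm, 'x) category_scheme \<Rightarrow>
     ('p \<Rightarrow> 'o) \<Rightarrow> ('n \<Rightarrow> 'm) \<Rightarrow> 'o \<Rightarrow> ('p \<Rightarrow> 'm) \<Rightarrow> bool" where
  "is_cone J C Fo Fa Z p \<longleftrightarrow> Z \<in> Obj C \<and> (\<forall>j\<in>Obj J. p j \<in> hom C Z (Fo j)) \<and>
     (\<forall>f\<in>Arr J. Fa f \<cdot>\<^bsub>C\<^esub> p (Dom J f) = p (Cod J f))"

definition is_limit_cone ::
  "('p, 'n, 'y) category_scheme \<Rightarrow> ('o, 'm, 'x) category_scheme \<Rightarrow>
     ('p \<Rightarrow> 'o) \<Rightarrow> ('n \<Rightarrow> 'm) \<Rightarrow> 'o \<Rightarrow> ('p \<Rightarrow> 'm) \<Rightarrow> bool" where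
  "is_limit_cone J C Fo Fa P p \<longleftrightarrow> is_cone J C Fo Fa P p \<and>
     (\<forall>Z q. is_cone J C Fo Fa Z q \<longrightarrow>
        (\<exists>!t. t \<in> hom C Z P \<and> (\<forall>j\<in>Obj J. p j \<cdot>\<^bsub>C\<^esub> t = q j)))"

text \<open>Every finite category is isomorphic to one whose objects and arrows are natural numbers.\<close>

definition has_finite_limits :: "('o, 'm, 'x) category_scheme \<Rightarrow> bool" where
  "has_finite_limits C \<longleftrightarrow>
     (\<forall>(J :: (nat, nat) category) Fo Fa.
        category J \<and> finite (Obj J) \<and> finite (Arr J) \<and> is_functor J C Fo Fa \<longrightarrow>
        (\<exists>P p. is_limit_cone J C Fo Fa P p))"

text \<open>
  The fibre product of the family of monomorphisms \<open>S\<close> into \<open>B\<close>, given by its arrow \<open>p\<close> into \<open>B\<close> and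
  its projections \<open>q s\<close>.  Since repeating a monomorphism does not change a fibre product,
  families indexed by classes amount to subsets of \<open>Arr C\<close>, which may be as large as \<open>C\<close> itself.
\<close>

definition is_intersection ::
  "('o, 'm, 'x) category_scheme \<Rightarrow> 'o \<Rightarrow> 'm set \<Rightarrow> 'm \<Rightarrow> ('m \<Rightarrow> 'm) \<Rightarrow> bool" where
  "is_intersection C B S p q \<longleftrightarrow> p \<in> Arr C \<and> Cod C p = B \<and>
     (\<forall>s\<in>S. q s \<in> hom C (Dom C p) (Dom C s) \<and> s \<cdot>\<^bsub>C\<^esub> q s = p) \<and>
     (\<forall>Z\<in>Obj C. \<forall>z\<in>hom C Z B. \<forall>y.
        (\<forall>s\<in>S. y s \<in> hom C Z (Dom C s) \<and> s \<cdot>\<^bsub>C\<^esub> y s = z) \<longrightarrow>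
        (\<exists>!t. t \<in> hom C Z (Dom C p) \<and> p \<cdot>\<^bsub>C\<^esub> t = z \<and> (\<forall>s\<in>S. q s \<cdot>\<^bsub>C\<^esub> t = y s)))"

definition finitely_well_complete :: "('o, 'm, 'x) category_scheme \<Rightarrow> bool" where
  "finitely_well_complete C \<longleftrightarrow> has_finite_limits C \<and>
     (\<forall>B\<in>Obj C. \<forall>S. (\<forall>s\<in>S. strong_mono C s \<and> Cod C s = B) \<longrightarrow>
        (\<exists>p q. is_intersection C B S p q))"


section \<open>Monads and their algebras\<close>

record ('o, 'm) monad =
  MObj :: "'o \<Rightarrow> 'o"
  MArr :: "'m \<Rightarrow> 'm"
  MUnit :: "'o \<Rightarrow> 'm"
  MMult :: "'o \<Rightarrow> 'm"

definition monad_morphism ::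
  "('o, 'm, 'x) category_scheme \<Rightarrow> ('o, 'm) monad \<Rightarrow> ('o, 'm) monad \<Rightarrow> ('o \<Rightarrow> 'm) \<Rightarrow> bool" where
  "monad_morphism C S T i \<longleftrightarrow>
     (\<forall>A\<in>Obj C. i A \<in> hom C (MObj S A) (MObj T A)) \<and>
     (\<forall>f\<in>Arr C. i (Cod C f) \<cdot>\<^bsub>C\<^esub> MArr S f = MArr T f \<cdot>\<^bsub>C\<^esub> i (Dom C f)) \<and>
     (\<forall>A\<in>Obj C. i A \<cdot>\<^bsub>C\<^esub> MUnit S A = MUnit T A) \<and>
     (\<forall>A\<in>Obj C. i A \<cdot>\<^bsub>C\<^esub> MMult S A = MMult T A \<cdot>\<^bsub>C\<^esub> MArr T (i A) \<cdot>\<^bsub>C\<^esub> i (MObj S A))"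

definition is_algebra ::
  "('o, 'm, 'x) category_scheme \<Rightarrow> ('o, 'm) monad \<Rightarrow> 'o \<times> 'm \<Rightarrow> bool" where
  "is_algebra C T A \<longleftrightarrow> fst A \<in> Obj C \<and> snd A \<in> hom C (MObj T (fst A)) (fst A) \<and>
     snd A \<cdot>\<^bsub>C\<^esub> MUnit T (fst A) = Id C (fst A) \<and>
     snd A \<cdot>\<^bsub>C\<^esub> MMult T (fst A) = snd A \<cdot>\<^bsub>C\<^esub> MArr T (snd A)"

type_synonym ('o, 'm) alg = "'o \<times> 'm"

text \<open>A homomorphism of algebras is \<open>(A, f, B)\<close> with domain \<open>A\<close>, codomain \<open>B\<close> and underlying arrow \<open>f\<close>.\<close>

type_synonym ('o, 'm) alg_arr = "('o, 'm) alg \<times> 'm \<times> ('o, 'm) alg"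

definition und :: "('o, 'm) alg_arr \<Rightarrow> 'm" where
  "und h = fst (snd h)"

definition EM ::
  "('o, 'm, 'x) category_scheme \<Rightarrow> ('o, 'm) monad \<Rightarrow> (('o, 'm) alg, ('o, 'm) alg_arr) category" where
  "EM C T =
     \<lparr> Obj = {A. is_algebra C T A},
       Arr = {(A, f, B). is_algebra C T A \<and> is_algebra C T B \<and> f \<in> hom C (fst A) (fst B) \<and>
                         f \<cdot>\<^bsub>C\<^esub> snd A = snd B \<cdot>\<^bsub>C\<^esub> MArr T f},
       Dom = (\<lambda>h. fst h),
       Cod = (\<lambda>h. snd (snd h)),
       Id = (\<lambda>A. (A, Id C (fst A), A)),
       Comp = (\<lambda>k h. (fst h, und k \<cdot>\<^bsub>C\<^esub> und h, snd (snd k))) \<rparr>"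

definition free_alg :: "('o, 'm) monad \<Rightarrow> 'o \<Rightarrow> ('o, 'm) alg" where
  "free_alg T A = (MObj T A, MMult T A)"

definition free_arr ::
  "('o, 'm, 'x) category_scheme \<Rightarrow> ('o, 'm) monad \<Rightarrow> 'm \<Rightarrow> ('o, 'm) alg_arr" where
  "free_arr C T f = (free_alg T (Dom C f), MArr T f, free_alg T (Cod C f))"

definition counit :: "('o, 'm) monad \<Rightarrow> ('o, 'm) alg \<Rightarrow> ('o, 'm) alg_arr" where
  "counit T A = (free_alg T (fst A), snd A, A)"


section \<open>Closed symmetric monoidal categories\<close>

record ('o, 'm) smc_category = "('o, 'm) category" +
  tens :: "'o \<Rightarrow> 'o \<Rightarrow> 'o"  (infixr \<open>\<boxtimes>\<index>\<close> 75)
  tensa :: "'m \<Rightarrow> 'm \<Rightarrow> 'm"  (infixr \<open>\<boxdot>\<index>\<close> 75)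
  unit :: "'o"
  assoc :: "'o \<Rightarrow> 'o \<Rightarrow> 'o \<Rightarrow> 'm"
  lunit :: "'o \<Rightarrow> 'm"
  runit :: "'o \<Rightarrow> 'm"
  symm :: "'o \<Rightarrow> 'o \<Rightarrow> 'm"
  ihom :: "'o \<Rightarrow> 'o \<Rightarrow> 'o"
  evl :: "'o \<Rightarrow> 'o \<Rightarrow> 'm"

locale closed_symmetric_monoidal_category = category X
  for X :: "('o, 'm, 'x) smc_category_scheme" (structure) +
  assumes tens_in: "A \<in> Obj X \<Longrightarrow> B \<in> Obj X \<Longrightarrow> A \<boxtimes> B \<in> Obj X"
    and tensa_in: "f \<in> hom X A B \<Longrightarrow> g \<in> hom X A' B' \<Longrightarrow> f \<boxdot> g \<in> hom X (A \<boxtimes> A') (B \<boxtimes> B')"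
    and tensa_Id: "A \<in> Obj X \<Longrightarrow> B \<in> Obj X \<Longrightarrow> Id X A \<boxdot> Id X B = Id X (A \<boxtimes> B)"
    and interchange:
      "f \<in> hom X A B \<Longrightarrow> g \<in> hom X B D \<Longrightarrow> f' \<in> hom X A' B' \<Longrightarrow> g' \<in> hom X B' D'
        \<Longrightarrow> (g \<cdot> f) \<boxdot> (g' \<cdot> f') = (g \<boxdot> g') \<cdot> (f \<boxdot> f')"
    and unit_in: "unit X \<in> Obj X"
    and assoc_in: "A \<in> Obj X \<Longrightarrow> B \<in> Obj X \<Longrightarrow> D \<in> Obj X
        \<Longrightarrow> assoc X A B D \<in> hom X ((A \<boxtimes> B) \<boxtimes> D) (A \<boxtimes> (B \<boxtimes> D))"
    and assoc_iso: "A \<in> Obj X \<Longrightarrow> B \<in> Obj X \<Longrightarrow> D \<in> Obj X \<Longrightarrow> iso_arr X (assoc X A B D)"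
    and assoc_natural:
      "f \<in> hom X A A' \<Longrightarrow> g \<in> hom X B B' \<Longrightarrow> h \<in> hom X D D'
        \<Longrightarrow> assoc X A' B' D' \<cdot> ((f \<boxdot> g) \<boxdot> h) = (f \<boxdot> (g \<boxdot> h)) \<cdot> assoc X A B D"
    and lunit_in: "A \<in> Obj X \<Longrightarrow> lunit X A \<in> hom X (unit X \<boxtimes> A) A"
    and lunit_iso: "A \<in> Obj X \<Longrightarrow> iso_arr X (lunit X A)"
    and lunit_natural: "f \<in> hom X A B \<Longrightarrow> lunit X B \<cdot> (Id X (unit X) \<boxdot> f) = f \<cdot> lunit X A"
    and runit_in: "A \<in> Obj X \<Longrightarrow> runit X A \<in> hom X (A \<boxtimes> unit X) A"
    and runit_iso: "A \<in> Obj X \<Longrightarrow> iso_arr X (runit X A)"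
    and runit_natural: "f \<in> hom X A B \<Longrightarrow> runit X B \<cdot> (f \<boxdot> Id X (unit X)) = f \<cdot> runit X A"
    and symm_in: "A \<in> Obj X \<Longrightarrow> B \<in> Obj X \<Longrightarrow> symm X A B \<in> hom X (A \<boxtimes> B) (B \<boxtimes> A)"
    and symm_symm: "A \<in> Obj X \<Longrightarrow> B \<in> Obj X \<Longrightarrow> symm X B A \<cdot> symm X A B = Id X (A \<boxtimes> B)"
    and symm_natural: "f \<in> hom X A A' \<Longrightarrow> g \<in> hom X B B'
        \<Longrightarrow> symm X A' B' \<cdot> (f \<boxdot> g) = (g \<boxdot> f) \<cdot> symm X A B"
    and pentagon:
      "A \<in> Obj X \<Longrightarrow> B \<in> Obj X \<Longrightarrow> D \<in> Obj X \<Longrightarrow> E \<in> Obj X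
        \<Longrightarrow> assoc X A B (D \<boxtimes> E) \<cdot> assoc X (A \<boxtimes> B) D E =
            (Id X A \<boxdot> assoc X B D E) \<cdot> assoc X A (B \<boxtimes> D) E \<cdot> (assoc X A B D \<boxdot> Id X E)"
    and triangle:
      "A \<in> Obj X \<Longrightarrow> B \<in> Obj X
        \<Longrightarrow> (Id X A \<boxdot> lunit X B) \<cdot> assoc X A (unit X) B = runit X A \<boxdot> Id X B"
    and symm_unit: "A \<in> Obj X \<Longrightarrow> lunit X A \<cdot> symm X A (unit X) = runit X A"
    and hexagon:
      "A \<in> Obj X \<Longrightarrow> B \<in> Obj X \<Longrightarrow> D \<in> Obj X
        \<Longrightarrow> assoc X B D A \<cdot> symm X A (B \<boxtimes> D) \<cdot> assoc X A B D =
            (Id X B \<boxdot> symm X A D) \<cdot> assoc X B A D \<cdot> (symm X A B \<boxdot> Id X D)"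
    and ihom_in: "A \<in> Obj X \<Longrightarrow> B \<in> Obj X \<Longrightarrow> ihom X A B \<in> Obj X"
    and evl_in: "A \<in> Obj X \<Longrightarrow> B \<in> Obj X \<Longrightarrow> evl X A B \<in> hom X (ihom X A B \<boxtimes> A) B"
    and closed:
      "Z \<in> Obj X \<Longrightarrow> A \<in> Obj X \<Longrightarrow> B \<in> Obj X \<Longrightarrow> f \<in> hom X (Z \<boxtimes> A) B
        \<Longrightarrow> \<exists>!g. g \<in> hom X Z (ihom X A B) \<and> evl X A B \<cdot> (g \<boxdot> Id X A) = f"

text \<open>Transposition along \<open>(-) \<boxtimes> A \<stileturn> ihom A (-)\<close>, for \<open>f : Z \<boxtimes> A \<rightarrow> B\<close> and \<open>g : Z \<rightarrow> ihom A B\<close>.\<close>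

definition transp ::
  "('o, 'm, 'x) smc_category_scheme \<Rightarrow> 'o \<Rightarrow> 'o \<Rightarrow> 'o \<Rightarrow> 'm \<Rightarrow> 'm" where
  "transp X Z A B f =
     (THE g. g \<in> hom X Z (ihom X A B) \<and> evl X A B \<cdot>\<^bsub>X\<^esub> (g \<boxdot>\<^bsub>X\<^esub> Id X A) = f)"

definition untransp :: "('o, 'm, 'x) smc_category_scheme \<Rightarrow> 'o \<Rightarrow> 'o \<Rightarrow> 'm \<Rightarrow> 'm" where
  "untransp X A B g = evl X A B \<cdot>\<^bsub>X\<^esub> (g \<boxdot>\<^bsub>X\<^esub> Id X A)"

text \<open>
  The category \<open>X\<close> enriched in itself: the element \<open>I \<rightarrow> ihom A B\<close> named by an arrow \<open>f : A \<rightarrow> B\<close>,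
  identities, composition, and the functors \<open>ihom f B\<close> and \<open>ihom A g\<close>.
\<close>

definition name_arr :: "('o, 'm, 'x) smc_category_scheme \<Rightarrow> 'm \<Rightarrow> 'm" where
  "name_arr X f = transp X (unit X) (Dom X f) (Cod X f) (f \<cdot>\<^bsub>X\<^esub> lunit X (Dom X f))"

definition ihom_id :: "('o, 'm, 'x) smc_category_scheme \<Rightarrow> 'o \<Rightarrow> 'm" where
  "ihom_id X A = transp X (unit X) A A (lunit X A)"

definition ihom_comp :: "('o, 'm, 'x) smc_category_scheme \<Rightarrow> 'o \<Rightarrow> 'o \<Rightarrow> 'o \<Rightarrow> 'm" where
  "ihom_comp X A B D =
     transp X (ihom X B D \<boxtimes>\<^bsub>X\<^esub> ihom X A B) A D
       (evl X B D \<cdot>\<^bsub>X\<^esub> (Id X (ihom X B D) \<boxdot>\<^bsub>X\<^esub> evl X A B)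
          \<cdot>\<^bsub>X\<^esub> assoc X (ihom X B D) (ihom X A B) A)"

definition ihom_pre :: "('o, 'm, 'x) smc_category_scheme \<Rightarrow> 'm \<Rightarrow> 'o \<Rightarrow> 'm" where
  "ihom_pre X f B =
     transp X (ihom X (Cod X f) B) (Dom X f) B
       (evl X (Cod X f) B \<cdot>\<^bsub>X\<^esub> (Id X (ihom X (Cod X f) B) \<boxdot>\<^bsub>X\<^esub> f))"

definition ihom_post :: "('o, 'm, 'x) smc_category_scheme \<Rightarrow> 'o \<Rightarrow> 'm \<Rightarrow> 'm" where
  "ihom_post X A g = transp X (ihom X A (Dom X g)) A (Cod X g) (g \<cdot>\<^bsub>X\<^esub> evl X A (Dom X g))"


section \<open>Enriched monads\<close>

text \<open>
  Monads on \<open>X\<close> enriched in itself; \<open>EStr L A B : ihom A B \<rightarrow> ihom (L A) (L B)\<close> is the action on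
  hom-objects, and \<open>EArr\<close> is the resulting action on arrows.
\<close>

record ('o, 'm) enriched_monad =
  EObj :: "'o \<Rightarrow> 'o"
  EStr :: "'o \<Rightarrow> 'o \<Rightarrow> 'm"
  EUnit :: "'o \<Rightarrow> 'm"
  EMult :: "'o \<Rightarrow> 'm"

definition EArr ::
  "('o, 'm, 'x) smc_category_scheme \<Rightarrow> ('o, 'm) enriched_monad \<Rightarrow> 'm \<Rightarrow> 'm" where
  "EArr X L f =
     (THE g. g \<in> hom X (EObj L (Dom X f)) (EObj L (Cod X f)) \<and>
             name_arr X g = EStr L (Dom X f) (Cod X f) \<cdot>\<^bsub>X\<^esub> name_arr X f)"

definition ordinary ::
  "('o, 'm, 'x) smc_category_scheme \<Rightarrow> ('o, 'm) enriched_monad \<Rightarrow> ('o, 'm) monad" where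
  "ordinary X L = \<lparr> MObj = EObj L, MArr = EArr X L, MUnit = EUnit L, MMult = EMult L \<rparr>"

locale enriched_monad = closed_symmetric_monoidal_category X
  for X :: "('o, 'm, 'x) smc_category_scheme" (structure)
  and L :: "('o, 'm) enriched_monad" +
  assumes EObj_in: "A \<in> Obj X \<Longrightarrow> EObj L A \<in> Obj X"
    and EStr_in: "A \<in> Obj X \<Longrightarrow> B \<in> Obj X
        \<Longrightarrow> EStr L A B \<in> hom X (ihom X A B) (ihom X (EObj L A) (EObj L B))"
    and EStr_id: "A \<in> Obj X \<Longrightarrow> EStr L A A \<cdot> ihom_id X A = ihom_id X (EObj L A)"
    and EStr_comp:
      "A \<in> Obj X \<Longrightarrow> B \<in> Obj X \<Longrightarrow> D \<in> Obj X
        \<Longrightarrow> EStr L A D \<cdot> ihom_comp X A B D =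
            ihom_comp X (EObj L A) (EObj L B) (EObj L D) \<cdot> (EStr L B D \<boxdot> EStr L A B)"
    and EUnit_in: "A \<in> Obj X \<Longrightarrow> EUnit L A \<in> hom X A (EObj L A)"
    and EUnit_natural:
      "A \<in> Obj X \<Longrightarrow> B \<in> Obj X
        \<Longrightarrow> ihom_post X A (EUnit L B) = ihom_pre X (EUnit L A) (EObj L B) \<cdot> EStr L A B"
    and EMult_in: "A \<in> Obj X \<Longrightarrow> EMult L A \<in> hom X (EObj L (EObj L A)) (EObj L A)"
    and EMult_natural:
      "A \<in> Obj X \<Longrightarrow> B \<in> Obj X
        \<Longrightarrow> ihom_post X (EObj L (EObj L A)) (EMult L B) \<cdot> EStr L (EObj L A) (EObj L B) \<cdot> EStr L A B =
            ihom_pre X (EMult L A) (EObj L B) \<cdot> EStr L A B"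
    and EMult_EUnit: "A \<in> Obj X \<Longrightarrow> EMult L A \<cdot> EUnit L (EObj L A) = Id X (EObj L A)"
    and EMult_EArr_EUnit: "A \<in> Obj X \<Longrightarrow> EMult L A \<cdot> EArr X L (EUnit L A) = Id X (EObj L A)"
    and EMult_EMult:
      "A \<in> Obj X \<Longrightarrow> EMult L A \<cdot> EMult L (EObj L A) = EMult L A \<cdot> EArr X L (EMult L A)"

text \<open>\<open>lstrength : L A \<boxtimes> B \<rightarrow> L (A \<boxtimes> B)\<close> and \<open>rstrength : A \<boxtimes> L B \<rightarrow> L (A \<boxtimes> B)\<close>.\<close>

definition lstrength ::
  "('o, 'm, 'x) smc_category_scheme \<Rightarrow> ('o, 'm) enriched_monad \<Rightarrow> 'o \<Rightarrow> 'o \<Rightarrow> 'm" where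
  "lstrength X L A B =
     untransp X (EObj L A) (EObj L (A \<boxtimes>\<^bsub>X\<^esub> B))
       (EStr L A (A \<boxtimes>\<^bsub>X\<^esub> B) \<cdot>\<^bsub>X\<^esub> transp X B A (A \<boxtimes>\<^bsub>X\<^esub> B) (symm X B A))
     \<cdot>\<^bsub>X\<^esub> symm X (EObj L A) B"

definition rstrength ::
  "('o, 'm, 'x) smc_category_scheme \<Rightarrow> ('o, 'm) enriched_monad \<Rightarrow> 'o \<Rightarrow> 'o \<Rightarrow> 'm" where
  "rstrength X L A B =
     untransp X (EObj L B) (EObj L (A \<boxtimes>\<^bsub>X\<^esub> B))
       (EStr L B (A \<boxtimes>\<^bsub>X\<^esub> B) \<cdot>\<^bsub>X\<^esub> transp X A B (A \<boxtimes>\<^bsub>X\<^esub> B) (Id X (A \<boxtimes>\<^bsub>X\<^esub> B)))"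

definition mtens ::
  "('o, 'm, 'x) smc_category_scheme \<Rightarrow> ('o, 'm) enriched_monad \<Rightarrow> 'o \<Rightarrow> 'o \<Rightarrow> 'm" where
  "mtens X L A B =
     EMult L (A \<boxtimes>\<^bsub>X\<^esub> B) \<cdot>\<^bsub>X\<^esub> EArr X L (lstrength X L A B) \<cdot>\<^bsub>X\<^esub> rstrength X L (EObj L A) B"

locale commutative_monad = enriched_monad X L
  for X :: "('o, 'm, 'x) smc_category_scheme" (structure)
  and L :: "('o, 'm) enriched_monad" +
  assumes commutative:
    "A \<in> Obj X \<Longrightarrow> B \<in> Obj X \<Longrightarrow>
       mtens X L A B =
       EMult L (A \<boxtimes> B) \<cdot> EArr X L (rstrength X L A B) \<cdot> lstrength X L A (EObj L B)"

abbreviation Lin ::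
  "('o, 'm, 'x) smc_category_scheme \<Rightarrow> ('o, 'm) enriched_monad \<Rightarrow>
     (('o, 'm) alg, ('o, 'm) alg_arr) category" where
  "Lin X L \<equiv> EM X (ordinary X L)"

abbreviation linear_space ::
  "('o, 'm, 'x) smc_category_scheme \<Rightarrow> ('o, 'm) enriched_monad \<Rightarrow> ('o, 'm) alg \<Rightarrow> bool" where
  "linear_space X L E \<equiv> E \<in> Obj (Lin X L)"

definition has_tensor_products ::
  "('o, 'm, 'x) smc_category_scheme \<Rightarrow> ('o, 'm) enriched_monad \<Rightarrow> bool" where
  "has_tensor_products X L \<longleftrightarrow>
     (\<forall>A B. linear_space X L A \<and> linear_space X L B \<longrightarrow>
        (let U = fst A; V = fst B;
             P = free_alg (ordinary X L) (EObj L U \<boxtimes>\<^bsub>X\<^esub> EObj L V);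
             Q = free_alg (ordinary X L) (U \<boxtimes>\<^bsub>X\<^esub> V)
         in \<exists>q. is_coequalizer (Lin X L)
                  (P, EMult L (U \<boxtimes>\<^bsub>X\<^esub> V) \<cdot>\<^bsub>X\<^esub> EArr X L (mtens X L U V), Q)
                  (P, EArr X L (snd A \<boxdot>\<^bsub>X\<^esub> snd B), Q) q))"


section \<open>Internal homs of linear spaces\<close>

text \<open>
  \<open>em_hom X L A B\<close> is the monomorphism from the hom-object of the enriched Eilenberg-Moore category
  to \<open>ihom (fst A) (fst B)\<close>, the equalizer of \<open>ihom (snd A) (fst B)\<close> and
  \<open>ihom (L (fst A)) (snd B) \<cdot> EStr (fst A) (fst B)\<close>.
\<close>

definition em_hom ::
  "('o, 'm, 'x) smc_category_scheme \<Rightarrow> ('o, 'm) enriched_monad \<Rightarrow>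
     ('o, 'm) alg \<Rightarrow> ('o, 'm) alg \<Rightarrow> 'm" where
  "em_hom X L A B =
     (SOME u. is_equalizer X (ihom_pre X (snd A) (fst B))
                (ihom_post X (EObj L (fst A)) (snd B) \<cdot>\<^bsub>X\<^esub> EStr L (fst A) (fst B)) u)"

definition em_eval ::
  "('o, 'm, 'x) smc_category_scheme \<Rightarrow> ('o, 'm) enriched_monad \<Rightarrow>
     ('o, 'm) alg \<Rightarrow> ('o, 'm) alg \<Rightarrow> 'm" where
  "em_eval X L A B = untransp X (fst A) (fst B) (em_hom X L A B)"

text \<open>
  The internal hom of linear spaces: its structure \<open>c : L P \<rightarrow> P\<close> on the hom-object \<open>P\<close> is the unique
  arrow for which evaluation \<open>P \<boxtimes> fst A \<rightarrow> fst B\<close>, which is linear in the second variable,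
  is linear in the first variable as well, i.e. is the bimorphism given by the evaluation
  of the closed structure.
\<close>

definition lin_hom ::
  "('o, 'm, 'x) smc_category_scheme \<Rightarrow> ('o, 'm) enriched_monad \<Rightarrow>
     ('o, 'm) alg \<Rightarrow> ('o, 'm) alg \<Rightarrow> ('o, 'm) alg" where
  "lin_hom X L A B =
     (let P = Dom X (em_hom X L A B)
      in (P, THE c. c \<in> hom X (EObj L P) P \<and>
               em_eval X L A B \<cdot>\<^bsub>X\<^esub> (c \<boxdot>\<^bsub>X\<^esub> Id X (fst A)) =
               snd B \<cdot>\<^bsub>X\<^esub> EArr X L (em_eval X L A B) \<cdot>\<^bsub>X\<^esub> lstrength X L P (fst A)))"

text \<open>\<open>lin_hom_pre X L h E : lin_hom B E \<rightarrow> lin_hom A E\<close> for \<open>h : A \<rightarrow> B\<close>.\<close>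

definition lin_hom_pre ::
  "('o, 'm, 'x) smc_category_scheme \<Rightarrow> ('o, 'm) enriched_monad \<Rightarrow>
     ('o, 'm) alg_arr \<Rightarrow> ('o, 'm) alg \<Rightarrow> ('o, 'm) alg_arr" where
  "lin_hom_pre X L h E =
     (let A = Dom (Lin X L) h; B = Cod (Lin X L) h
      in (lin_hom X L B E,
          THE v. v \<in> hom X (fst (lin_hom X L B E)) (fst (lin_hom X L A E)) \<and>
                 em_hom X L A E \<cdot>\<^bsub>X\<^esub> v = ihom_pre X (und h) (fst E) \<cdot>\<^bsub>X\<^esub> em_hom X L B E,
          lin_hom X L A E))"


section \<open>Double dualization\<close>

definition ground ::
  "('o, 'm, 'x) smc_category_scheme \<Rightarrow> ('o, 'm) enriched_monad \<Rightarrow> ('o, 'm) alg" where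
  "ground X L = free_alg (ordinary X L) (unit X)"

definition dual ::
  "('o, 'm, 'x) smc_category_scheme \<Rightarrow> ('o, 'm) enriched_monad \<Rightarrow> ('o, 'm) alg \<Rightarrow> ('o, 'm) alg" where
  "dual X L E = lin_hom X L E (ground X L)"

definition dual_arr ::
  "('o, 'm, 'x) smc_category_scheme \<Rightarrow> ('o, 'm) enriched_monad \<Rightarrow>
     ('o, 'm) alg_arr \<Rightarrow> ('o, 'm) alg_arr" where
  "dual_arr X L h = lin_hom_pre X L h (ground X L)"

text \<open>
  The unit \<open>E \<rightarrow> E**\<close> of the self-adjunction of dualization, the transpose of the evaluation
  \<open>E \<boxtimes> E* \<rightarrow> R\<close>.  In the opposite category the counit at \<open>E*\<close> is this same unit, whence the
  multiplication \<open>E**** \<rightarrow> E**\<close> below.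
\<close>

definition dd_unit ::
  "('o, 'm, 'x) smc_category_scheme \<Rightarrow> ('o, 'm) enriched_monad \<Rightarrow>
     ('o, 'm) alg \<Rightarrow> ('o, 'm) alg_arr" where
  "dd_unit X L E =
     (let R = ground X L; E' = dual X L E; E'' = dual X L E'
      in (E,
          THE d. d \<in> hom X (fst E) (fst E'') \<and>
                 em_hom X L E' R \<cdot>\<^bsub>X\<^esub> d =
                 transp X (fst E) (fst E') (fst R)
                   (em_eval X L E R \<cdot>\<^bsub>X\<^esub> symm X (fst E) (fst E')),
          E''))"

definition ddual_monad ::
  "('o, 'm, 'x) smc_category_scheme \<Rightarrow> ('o, 'm) enriched_monad \<Rightarrow>
     (('o, 'm) alg, ('o, 'm) alg_arr) monad" where
  "ddual_monad X L =
     \<lparr> MObj = (\<lambda>E. dual X L (dual X L E)),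
       MArr = (\<lambda>h. dual_arr X L (dual_arr X L h)),
       MUnit = dd_unit X L,
       MMult = (\<lambda>E. dual_arr X L (dd_unit X L (dual X L E))) \<rparr>"

definition separated ::
  "('o, 'm, 'x) smc_category_scheme \<Rightarrow> ('o, 'm) enriched_monad \<Rightarrow> ('o, 'm) alg \<Rightarrow> bool" where
  "separated X L E \<longleftrightarrow> linear_space X L E \<and> strong_mono (Lin X L) (dd_unit X L E)"

definition functionally_complete ::
  "('o, 'm, 'x) smc_category_scheme \<Rightarrow> ('o, 'm) enriched_monad \<Rightarrow> ('o, 'm) alg \<Rightarrow> bool" where
  "functionally_complete X L E \<longleftrightarrow> linear_space X L E \<and>
     (\<forall>h\<in>Arr (Lin X L). iso_arr (Lin X L) (dual_arr X L (dual_arr X L h)) \<longrightarrow>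
        iso_arr (Lin X L) (lin_hom_pre X L h E))"


section \<open>Accessible distributions\<close>

text \<open>
  \<open>r\<close> assigns to each linear space \<open>E\<close> its reflection arrow into the full subcategory of
  functionally complete linear spaces.  Reflectivity is understood in the enriched sense: the
  bijections on homs are isomorphisms of linear spaces \<open>lin_hom (Cod (r E)) B \<rightarrow> lin_hom E B\<close>.
\<close>

definition fc_reflection ::
  "('o, 'm, 'x) smc_category_scheme \<Rightarrow> ('o, 'm) enriched_monad \<Rightarrow>
     (('o, 'm) alg \<Rightarrow> ('o, 'm) alg_arr) \<Rightarrow> bool" where
  "fc_reflection X L r \<longleftrightarrow>
     (\<forall>E. linear_space X L E \<longrightarrow>
        r E \<in> Arr (Lin X L) \<and> Dom (Lin X L) (r E) = E \<and>
        functionally_complete X L (Cod (Lin X L) (r E)) \<and>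
        (\<forall>B. functionally_complete X L B \<longrightarrow> iso_arr (Lin X L) (lin_hom_pre X L (r E) B)))"

text \<open>The idempotent monad on linear spaces induced by the reflection \<open>r\<close>.\<close>

definition refl_monad ::
  "('o, 'm, 'x) smc_category_scheme \<Rightarrow> ('o, 'm) enriched_monad \<Rightarrow>
     (('o, 'm) alg \<Rightarrow> ('o, 'm) alg_arr) \<Rightarrow> (('o, 'm) alg, ('o, 'm) alg_arr) monad" where
  "refl_monad X L r =
     (let V = Lin X L; K = (\<lambda>E. Cod V (r E))
      in \<lparr> MObj = K,
           MArr = (\<lambda>h. THE k. k \<in> hom V (K (Dom V h)) (K (Cod V h)) \<and>
                              k \<cdot>\<^bsub>V\<^esub> r (Dom V h) = r (Cod V h) \<cdot>\<^bsub>V\<^esub> h),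
           MUnit = r,
           MMult = (\<lambda>E. THE k. k \<in> hom V (K (K E)) (K E) \<and> k \<cdot>\<^bsub>V\<^esub> r (K E) = Id V (K E)) \<rparr>)"

text \<open>
  The accessible distribution monad, as an ordinary monad on \<open>X\<close>; an algebra of an enriched monad
  is an algebra of its underlying ordinary monad.
\<close>

definition acc_monad ::
  "('o, 'm, 'x) smc_category_scheme \<Rightarrow> ('o, 'm) enriched_monad \<Rightarrow>
     (('o, 'm) alg \<Rightarrow> ('o, 'm) alg_arr) \<Rightarrow> ('o, 'm) monad" where
  "acc_monad X L r =
     (let T = ordinary X L; K = refl_monad X L r; F = free_alg T
      in \<lparr> MObj = (\<lambda>A. fst (MObj K (F A))),
           MArr = (\<lambda>f. und (MArr K (free_arr X T f))),
           MUnit = (\<lambda>A. und (MUnit K (F A)) \<cdot>\<^bsub>X\<^esub> EUnit L A),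
           MMult = (\<lambda>A. und (MMult K (F A)) \<cdot>\<^bsub>X\<^esub> und (MArr K (counit T (MObj K (F A))))) \<rparr>)"

definition underlying_space ::
  "('o, 'm, 'x) smc_category_scheme \<Rightarrow> ('o, 'm) enriched_monad \<Rightarrow>
     (('o, 'm) alg \<Rightarrow> ('o, 'm) alg_arr) \<Rightarrow> ('o, 'm) alg \<Rightarrow> ('o, 'm) alg" where
  "underlying_space X L r A =
     (fst A, snd A \<cdot>\<^bsub>X\<^esub> und (MUnit (refl_monad X L r) (free_alg (ordinary X L) (fst A))))"

definition acc_xi ::
  "('o, 'm, 'x) smc_category_scheme \<Rightarrow> ('o, 'm) enriched_monad \<Rightarrow>
     (('o, 'm) alg \<Rightarrow> ('o, 'm) alg_arr) \<Rightarrow> (('o, 'm) alg \<Rightarrow> ('o, 'm) alg_arr) \<Rightarrow>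
     ('o, 'm) alg \<Rightarrow> 'm" where
  "acc_xi X L r i E = und (i E) \<cdot>\<^bsub>X\<^esub> und (MArr (refl_monad X L r) (counit (ordinary X L) E))"

definition is_pettis_structure ::
  "('o, 'm, 'x) smc_category_scheme \<Rightarrow> ('o, 'm) enriched_monad \<Rightarrow>
     (('o, 'm) alg \<Rightarrow> ('o, 'm) alg_arr) \<Rightarrow> (('o, 'm) alg \<Rightarrow> ('o, 'm) alg_arr) \<Rightarrow>
     ('o, 'm) alg \<Rightarrow> 'm \<Rightarrow> bool" where
  "is_pettis_structure X L r i E a \<longleftrightarrow>
     a \<in> hom X (MObj (acc_monad X L r) (fst E)) (fst E) \<and>
     und (dd_unit X L E) \<cdot>\<^bsub>X\<^esub> a = acc_xi X L r i E"

definition pettis_space ::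
  "('o, 'm, 'x) smc_category_scheme \<Rightarrow> ('o, 'm) enriched_monad \<Rightarrow>
     (('o, 'm) alg \<Rightarrow> ('o, 'm) alg_arr) \<Rightarrow> (('o, 'm) alg \<Rightarrow> ('o, 'm) alg_arr) \<Rightarrow>
     ('o, 'm) alg \<Rightarrow> bool" where
  "pettis_space X L r i E \<longleftrightarrow> separated X L E \<and> (\<exists>a. is_pettis_structure X L r i E a)"

definition pettis_algebra ::
  "('o, 'm, 'x) smc_category_scheme \<Rightarrow> ('o, 'm) enriched_monad \<Rightarrow>
     (('o, 'm) alg \<Rightarrow> ('o, 'm) alg_arr) \<Rightarrow> (('o, 'm) alg \<Rightarrow> ('o, 'm) alg_arr) \<Rightarrow>
     ('o, 'm) alg \<Rightarrow> bool" where
  "pettis_algebra X L r i A \<longleftrightarrow> is_algebra X (acc_monad X L r) A \<and>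
     (\<exists>E. pettis_space X L r i E \<and> A = (fst E, THE a. is_pettis_structure X L r i E a))"

end

theory Submission
  imports Defs
begin

text \<open>
  For an algebra \<open>(X, a)\<close> with underlying linear space \<open>E\<close>, the structure \<open>a\<close> is a linear map from the
  reflection of \<open>FX\<close> to \<open>E\<close> that extends the counit \<open>FX \<rightarrow> E\<close>.  Hence \<open>\<dd>\<^sub>E \<cdot> a\<close> and the map \<open>\<xi>\<close> of \<open>E\<close> are
  linear maps into \<open>E**\<close> with the same restriction to \<open>FX\<close>.  They coincide, since \<open>E**\<close> embeds into
  a functionally complete space: its reflection, through which the split monomorphism
  \<open>E** \<rightarrow> E****\<close> factors.  Conversely, a Pettis structure \<open>a\<close> on \<open>E\<close> extends the counit because the
  monomorphism \<open>\<dd>\<^sub>E\<close> can be cancelled, so that \<open>E\<close> is recovered as the underlying linear space.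
\<close>

section \<open>Symmetric monoidal closed categories\<close>

text \<open>The monad is given by its action on hom-objects and the reflection by isomorphisms of
  internal homs, whereas algebras, linearity and cancellation concern plain arrows. The two levels
  are linked by points of hom-objects, arrows out of the unit object: functoriality of
  \<open>L\<close>, naturality of its strengths and the extension of linear maps along the
  reflection are all obtained through them. Internal homs are choices made by \<open>SOME\<close>
  and \<open>THE\<close>, so they are handled mainly through the universal property of evaluation
  among maps linear in the second variable. A direct proof that E** is functionally complete would
  have to rewrite internal homs into E** as internal homs between duals; the detour through the
  reflection of E** asks only for unique extension into reflections, the unit law of
  \<open>i\<close>, and cancellation of the double-dualization unit at a dual.\<close>

lemma in_hom_iff: "f \<in> hom C A B \<longleftrightarrow> f \<in> Arr C \<and> Dom C f = A \<and> Cod C f = B"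
  by (simp add: hom_def)

lemma iso_arrD:
  assumes "iso_arr C f"
  obtains g where "g \<in> Arr C" "Dom C g = Cod C f" "Cod C g = Dom C f"
    "g \<cdot>\<^bsub>C\<^esub> f = Id C (Dom C f)" "f \<cdot>\<^bsub>C\<^esub> g = Id C (Cod C f)" "f \<in> Arr C"
  using assms by (auto simp: iso_arr_def in_hom_iff)

context category
begin

lemma Dom_Obj [simp]: "f \<in> Arr C \<Longrightarrow> Dom C f \<in> Obj C"
  and Cod_Obj [simp]: "f \<in> Arr C \<Longrightarrow> Cod C f \<in> Obj C"
  by (auto simp: Dom_in Cod_in)

lemma Id_simps [simp]:
  assumes "A \<in> Obj C"
  shows "Id C A \<in> Arr C" "Dom C (Id C A) = A" "Cod C (Id C A) = A"
  using Id_in[OF assms] by (auto simp: in_hom_iff)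

lemma Comp_simps [simp]:
  assumes "f \<in> Arr C" "g \<in> Arr C" "Dom C g = Cod C f"
  shows "g \<cdot> f \<in> Arr C" "Dom C (g \<cdot> f) = Dom C f" "Cod C (g \<cdot> f) = Cod C g"
  using Comp_in[of f "Dom C f" "Cod C f" g "Cod C g"] assms by (auto simp: in_hom_iff)

lemma Comp_assoc' [simp]:
  assumes "f \<in> Arr C" "g \<in> Arr C" "h \<in> Arr C" "Dom C g = Cod C f" "Dom C h = Cod C g"
  shows "(h \<cdot> g) \<cdot> f = h \<cdot> g \<cdot> f"
  using Comp_assoc[of f "Dom C f" "Cod C f" g "Cod C g" h "Cod C h"] assms
  by (auto simp: in_hom_iff)

lemma Comp_Id' [simp]: "f \<in> Arr C \<Longrightarrow> A = Dom C f \<Longrightarrow> f \<cdot> Id C A = f"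
  using Comp_Id[of f "Dom C f" "Cod C f"] by (auto simp: in_hom_iff)

lemma Id_Comp' [simp]: "f \<in> Arr C \<Longrightarrow> A = Cod C f \<Longrightarrow> Id C A \<cdot> f = f"
  using Id_Comp[of f "Dom C f" "Cod C f"] by (auto simp: in_hom_iff)

lemma iso_epic:
  assumes "iso_arr C f" "g \<in> Arr C" "h \<in> Arr C" "Dom C g = Cod C f" "Dom C h = Cod C f"
    "g \<cdot> f = h \<cdot> f"
  shows "g = h"
proof -
  obtain f' where f': "f' \<in> Arr C" "Dom C f' = Cod C f" "Cod C f' = Dom C f"
    "f' \<cdot> f = Id C (Dom C f)" "f \<cdot> f' = Id C (Cod C f)" "f \<in> Arr C"
    using iso_arrD[OF assms(1)] by blast
  have "(g \<cdot> f) \<cdot> f' = (h \<cdot> f) \<cdot> f'"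
    using assms by simp
  then show ?thesis
    using f' assms(2-5) by simp
qed

lemma iso_Comp:
  assumes "iso_arr C f" "iso_arr C g" "Dom C g = Cod C f"
  shows "iso_arr C (g \<cdot> f)"
proof -
  obtain f' where f': "f' \<in> Arr C" "Dom C f' = Cod C f" "Cod C f' = Dom C f"
    "f' \<cdot> f = Id C (Dom C f)" "f \<cdot> f' = Id C (Cod C f)" "f \<in> Arr C"
    using iso_arrD[OF assms(1)] by blast
  obtain g' where g': "g' \<in> Arr C" "Dom C g' = Cod C g" "Cod C g' = Dom C g"
    "g' \<cdot> g = Id C (Dom C g)" "g \<cdot> g' = Id C (Cod C g)" "g \<in> Arr C"
    using iso_arrD[OF assms(2)] by blast
  have "(f' \<cdot> g') \<cdot> (g \<cdot> f) = f' \<cdot> (g' \<cdot> g) \<cdot> f"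
    "(g \<cdot> f) \<cdot> (f' \<cdot> g') = g \<cdot> (f \<cdot> f') \<cdot> g'"
    using f'(1-3,6) g'(1-3,6) assms(3) by simp_all
  then show ?thesis
    unfolding iso_arr_def using f' g' assms(3) by (auto simp: in_hom_iff intro!: bexI[of _ "f' \<cdot> g'"])
qed

end

section \<open>Tensor calculus and coherence at the unit object\<close>

context closed_symmetric_monoidal_category
begin

lemma object_simps [simp]:
  "unit X \<in> Obj X"
  "A \<in> Obj X \<Longrightarrow> B \<in> Obj X \<Longrightarrow> A \<boxtimes> B \<in> Obj X"
  "A \<in> Obj X \<Longrightarrow> B \<in> Obj X \<Longrightarrow> ihom X A B \<in> Obj X"
  by (auto simp: unit_in tens_in ihom_in)

lemma tensa_simps [simp]:
  assumes "f \<in> Arr X" "g \<in> Arr X"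
  shows "f \<boxdot> g \<in> Arr X" "Dom X (f \<boxdot> g) = Dom X f \<boxtimes> Dom X g"
    "Cod X (f \<boxdot> g) = Cod X f \<boxtimes> Cod X g"
  using tensa_in[of f "Dom X f" "Cod X f" g "Dom X g" "Cod X g"] assms by (auto simp: in_hom_iff)

declare tensa_Id [simp]

lemma interchange' [simp]:
  assumes "f \<in> Arr X" "g \<in> Arr X" "f' \<in> Arr X" "g' \<in> Arr X"
    "Dom X g = Cod X f" "Dom X g' = Cod X f'"
  shows "(g \<boxdot> g') \<cdot> (f \<boxdot> f') = (g \<cdot> f) \<boxdot> (g' \<cdot> f')"
  using interchange[of f "Dom X f" "Cod X f" g "Cod X g" f' "Dom X f'" "Cod X f'" g' "Cod X g'"]
    assms by (auto simp: in_hom_iff)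

lemma interchange_Comp [simp]:
  assumes "f \<in> Arr X" "g \<in> Arr X" "f' \<in> Arr X" "g' \<in> Arr X" "h \<in> Arr X"
    "Dom X g = Cod X f" "Dom X g' = Cod X f'" "Cod X h = Dom X f \<boxtimes> Dom X f'"
  shows "(g \<boxdot> g') \<cdot> (f \<boxdot> f') \<cdot> h = ((g \<cdot> f) \<boxdot> (g' \<cdot> f')) \<cdot> h"
proof -
  have "(g \<boxdot> g') \<cdot> (f \<boxdot> f') \<cdot> h = ((g \<boxdot> g') \<cdot> (f \<boxdot> f')) \<cdot> h"
    using assms by (simp del: interchange')
  then show ?thesis using assms by simp
qed

lemma assoc_simps [simp]:
  assumes "A \<in> Obj X" "B \<in> Obj X" "D \<in> Obj X"
  shows "assoc X A B D \<in> Arr X" "Dom X (assoc X A B D) = (A \<boxtimes> B) \<boxtimes> D"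
    "Cod X (assoc X A B D) = A \<boxtimes> (B \<boxtimes> D)"
  using assoc_in[OF assms] by (auto simp: in_hom_iff)

lemma lunit_simps [simp]:
  assumes "A \<in> Obj X"
  shows "lunit X A \<in> Arr X" "Dom X (lunit X A) = unit X \<boxtimes> A" "Cod X (lunit X A) = A"
  using lunit_in[OF assms] by (auto simp: in_hom_iff)

lemma runit_simps [simp]:
  assumes "A \<in> Obj X"
  shows "runit X A \<in> Arr X" "Dom X (runit X A) = A \<boxtimes> unit X" "Cod X (runit X A) = A"
  using runit_in[OF assms] by (auto simp: in_hom_iff)

lemma symm_simps [simp]:
  assumes "A \<in> Obj X" "B \<in> Obj X"
  shows "symm X A B \<in> Arr X" "Dom X (symm X A B) = A \<boxtimes> B" "Cod X (symm X A B) = B \<boxtimes> A"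
  using symm_in[OF assms] by (auto simp: in_hom_iff)

lemma evl_simps [simp]:
  assumes "A \<in> Obj X" "B \<in> Obj X"
  shows "evl X A B \<in> Arr X" "Dom X (evl X A B) = ihom X A B \<boxtimes> A" "Cod X (evl X A B) = B"
  using evl_in[OF assms] by (auto simp: in_hom_iff)

lemma assoc_natural':
  assumes "f \<in> Arr X" "g \<in> Arr X" "h \<in> Arr X"
  shows "assoc X (Cod X f) (Cod X g) (Cod X h) \<cdot> ((f \<boxdot> g) \<boxdot> h) =
    (f \<boxdot> (g \<boxdot> h)) \<cdot> assoc X (Dom X f) (Dom X g) (Dom X h)"
  using assoc_natural[of f _ _ g _ _ h] assms by (auto simp: in_hom_iff)

lemma lunit_natural': "f \<in> Arr X \<Longrightarrow> lunit X (Cod X f) \<cdot> (Id X (unit X) \<boxdot> f) = f \<cdot> lunit X (Dom X f)"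
  using lunit_natural[of f] by (auto simp: in_hom_iff)

lemma symm_natural':
  "f \<in> Arr X \<Longrightarrow> g \<in> Arr X \<Longrightarrow>
    symm X (Cod X f) (Cod X g) \<cdot> (f \<boxdot> g) = (g \<boxdot> f) \<cdot> symm X (Dom X f) (Dom X g)"
  using symm_natural[of f _ _ g] by (auto simp: in_hom_iff)

lemma iso_tensa_Id:
  assumes "iso_arr X f" "A \<in> Obj X"
  shows "iso_arr X (f \<boxdot> Id X A)"
proof -
  obtain f' where "f' \<in> Arr X" "Dom X f' = Cod X f" "Cod X f' = Dom X f"
    "f' \<cdot> f = Id X (Dom X f)" "f \<cdot> f' = Id X (Cod X f)" "f \<in> Arr X"
    using iso_arrD[OF assms(1)] by blast
  then show ?thesis
    unfolding iso_arr_def using assms(2)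
    by (auto simp: in_hom_iff intro!: bexI[of _ "f' \<boxdot> Id X A"])
qed

text \<open>Naturality of \<open>lunit\<close> exhibits \<open>f\<close> as the conjugate of
  \<open>Id X (unit X) \<boxdot> f\<close> by isomorphisms, so tensoring with the unit object loses
  nothing.\<close>

lemma unit_tensa_faithful:
  assumes "f \<in> Arr X" "g \<in> Arr X" "Dom X f = Dom X g" "Cod X f = Cod X g"
    "Id X (unit X) \<boxdot> f = Id X (unit X) \<boxdot> g"
  shows "f = g"
proof (rule iso_epic)
  show "f \<cdot> lunit X (Dom X f) = g \<cdot> lunit X (Dom X f)"
    using lunit_natural'[of f] lunit_natural'[of g] assms by simp
qed (use assms in \<open>auto intro: lunit_iso\<close>)

text \<open>Kelly's argument: the pentagon and the triangle give the equation after tensoring with the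
  unit object, which is faithful.\<close>

lemma lunit_tens:
  assumes A: "A \<in> Obj X" and B: "B \<in> Obj X"
  shows "lunit X (A \<boxtimes> B) \<cdot> assoc X (unit X) A B = lunit X A \<boxdot> Id X B"
proof (rule unit_tensa_faithful)
  let ?I = "unit X"
  \<comment> \<open>Two of the three edges on the longer side of the pentagon for I, I, A, B. They
    are invertible, so the claim may be tested after composing with them; the third edge is the
    associator of the claim, tensored with I.\<close>
  let ?e = "assoc X ?I (?I \<boxtimes> A) B \<cdot> (assoc X ?I ?I A \<boxdot> Id X B)"
  show "Id X ?I \<boxdot> (lunit X (A \<boxtimes> B) \<cdot> assoc X ?I A B) = Id X ?I \<boxdot> (lunit X A \<boxdot> Id X B)"
  proof (rule iso_epic[of ?e])
    have "(Id X ?I \<boxdot> (lunit X (A \<boxtimes> B) \<cdot> assoc X ?I A B)) \<cdot> ?e =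
        (Id X ?I \<boxdot> lunit X (A \<boxtimes> B)) \<cdot> (Id X ?I \<boxdot> assoc X ?I A B) \<cdot> ?e"
      using A B by simp
    also have "\<dots> = (Id X ?I \<boxdot> lunit X (A \<boxtimes> B)) \<cdot> assoc X ?I ?I (A \<boxtimes> B) \<cdot> assoc X (?I \<boxtimes> ?I) A B"
      using pentagon[of ?I ?I A B] A B by simp
    also have "\<dots> = (runit X ?I \<boxdot> Id X (A \<boxtimes> B)) \<cdot> assoc X (?I \<boxtimes> ?I) A B"
      using triangle[of ?I "A \<boxtimes> B"] A B by (simp flip: Comp_assoc')
    also have "\<dots> = assoc X ?I A B \<cdot> ((runit X ?I \<boxdot> Id X A) \<boxdot> Id X B)"
      using assoc_natural'[of "runit X ?I" "Id X A" "Id X B"] A B by simp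
    also have "\<dots> = assoc X ?I A B \<cdot> ((Id X ?I \<boxdot> lunit X A) \<boxdot> Id X B) \<cdot> (assoc X ?I ?I A \<boxdot> Id X B)"
      using triangle[of ?I A] A B by simp
    also have "\<dots> = (Id X ?I \<boxdot> (lunit X A \<boxdot> Id X B)) \<cdot> ?e"
      using assoc_natural'[of "Id X ?I" "lunit X A" "Id X B"] A B
      by (simp flip: Comp_assoc' del: interchange')
    finally show "(Id X ?I \<boxdot> (lunit X (A \<boxtimes> B) \<cdot> assoc X ?I A B)) \<cdot> ?e =
        (Id X ?I \<boxdot> (lunit X A \<boxdot> Id X B)) \<cdot> ?e" .
  qed (use A B in \<open>auto intro!: iso_Comp iso_tensa_Id assoc_iso\<close>)
qed (use A B in auto)

section \<open>Transposition and points of hom-objects\<close>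

lemma transp_props:
  assumes "Z \<in> Obj X" "A \<in> Obj X" "B \<in> Obj X" "f \<in> Arr X" "Dom X f = Z \<boxtimes> A" "Cod X f = B"
  shows "transp X Z A B f \<in> hom X Z (ihom X A B) \<and> evl X A B \<cdot> (transp X Z A B f \<boxdot> Id X A) = f"
proof -
  have "\<exists>!g. g \<in> hom X Z (ihom X A B) \<and> evl X A B \<cdot> (g \<boxdot> Id X A) = f"
    using closed[of Z A B f] assms by (auto simp: in_hom_iff)
  from theI'[OF this] show ?thesis
    unfolding transp_def by blast
qed

lemma transp_simps [simp]:
  assumes "Z \<in> Obj X" "A \<in> Obj X" "B \<in> Obj X" "f \<in> Arr X" "Dom X f = Z \<boxtimes> A" "Cod X f = B"
  shows "transp X Z A B f \<in> Arr X" "Dom X (transp X Z A B f) = Z"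
    "Cod X (transp X Z A B f) = ihom X A B" "untransp X A B (transp X Z A B f) = f"
  using transp_props[OF assms] by (auto simp: untransp_def in_hom_iff)

lemma untransp_simps [simp]:
  assumes "A \<in> Obj X" "B \<in> Obj X" "g \<in> Arr X" "Cod X g = ihom X A B"
  shows "untransp X A B g \<in> Arr X" "Dom X (untransp X A B g) = Dom X g \<boxtimes> A"
    "Cod X (untransp X A B g) = B"
  using assms by (simp_all add: untransp_def)

lemma untransp_inject:
  assumes "A \<in> Obj X" "B \<in> Obj X" "g \<in> Arr X" "Cod X g = ihom X A B" "h \<in> Arr X"
    "Cod X h = ihom X A B" "Dom X g = Dom X h" "untransp X A B g = untransp X A B h"
  shows "g = h"
  using closed[of "Dom X g" A B "untransp X A B h"] assms
  by (auto simp: untransp_def in_hom_iff)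

lemma untransp_Comp:
  assumes "A \<in> Obj X" "B \<in> Obj X" "g \<in> Arr X" "Cod X g = ihom X A B" "z \<in> Arr X" "Cod X z = Dom X g"
  shows "untransp X A B (g \<cdot> z) = untransp X A B g \<cdot> (z \<boxdot> Id X A)"
  using assms by (simp add: untransp_def)

lemma transp_untransp [simp]:
  assumes "A \<in> Obj X" "B \<in> Obj X" "g \<in> Arr X" "Cod X g = ihom X A B" "Z = Dom X g"
  shows "transp X Z A B (untransp X A B g) = g"
  by (rule untransp_inject[of A B]) (use assms in auto)

lemma ihom_pre_simps [simp]:
  assumes "f \<in> Arr X" "B \<in> Obj X"
  shows "ihom_pre X f B \<in> Arr X" "Dom X (ihom_pre X f B) = ihom X (Cod X f) B"
    "Cod X (ihom_pre X f B) = ihom X (Dom X f) B"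
  using assms by (simp_all add: ihom_pre_def)

lemma ihom_post_simps [simp]:
  assumes "g \<in> Arr X" "A \<in> Obj X"
  shows "ihom_post X A g \<in> Arr X" "Dom X (ihom_post X A g) = ihom X A (Dom X g)"
    "Cod X (ihom_post X A g) = ihom X A (Cod X g)"
  using assms by (simp_all add: ihom_post_def)

lemma untransp_ihom_pre:
  assumes "f \<in> Arr X" "B \<in> Obj X" "h \<in> Arr X" "Cod X h = ihom X (Cod X f) B" "A = Dom X f"
  shows "untransp X A B (ihom_pre X f B \<cdot> h) =
    untransp X (Cod X f) B h \<cdot> (Id X (Dom X h) \<boxdot> f)"
proof -
  have "untransp X A B (ihom_pre X f B \<cdot> h) = untransp X A B (ihom_pre X f B) \<cdot> (h \<boxdot> Id X A)"
    using assms by (simp add: untransp_Comp)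
  also have "untransp X A B (ihom_pre X f B) =
      evl X (Cod X f) B \<cdot> (Id X (ihom X (Cod X f) B) \<boxdot> f)"
    using assms by (simp add: ihom_pre_def)
  finally show ?thesis
    using assms by (simp add: untransp_def)
qed

lemma untransp_ihom_post:
  assumes "g \<in> Arr X" "A \<in> Obj X" "h \<in> Arr X" "Cod X h = ihom X A (Dom X g)" "B = Cod X g"
  shows "untransp X A B (ihom_post X A g \<cdot> h) = g \<cdot> untransp X A (Dom X g) h"
proof -
  have "untransp X A B (ihom_post X A g \<cdot> h) = untransp X A B (ihom_post X A g) \<cdot> (h \<boxdot> Id X A)"
    using assms by (simp add: untransp_Comp)
  also have "untransp X A B (ihom_post X A g) = g \<cdot> evl X A (Dom X g)"
    using assms by (simp add: ihom_post_def)
  finally show ?thesis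
    using assms by (simp add: untransp_def)
qed

lemma name_arr_simps [simp]:
  assumes "f \<in> Arr X"
  shows "name_arr X f \<in> Arr X" "Dom X (name_arr X f) = unit X"
    "Cod X (name_arr X f) = ihom X (Dom X f) (Cod X f)"
  using assms by (simp_all add: name_arr_def)

lemma untransp_name_arr:
  "f \<in> Arr X \<Longrightarrow> A = Dom X f \<Longrightarrow> B = Cod X f \<Longrightarrow>
    untransp X A B (name_arr X f) = f \<cdot> lunit X (Dom X f)"
  by (simp add: name_arr_def)

lemma name_arr_Id: "A \<in> Obj X \<Longrightarrow> name_arr X (Id X A) = ihom_id X A"
  by (simp add: name_arr_def ihom_id_def)

lemma name_arr_inject:
  assumes "f \<in> Arr X" "g \<in> Arr X" "Dom X f = Dom X g" "Cod X f = Cod X g"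
    "name_arr X f = name_arr X g"
  shows "f = g"
proof (rule iso_epic)
  show "f \<cdot> lunit X (Dom X f) = g \<cdot> lunit X (Dom X f)"
    using untransp_name_arr[of f] untransp_name_arr[of g] assms by simp
qed (use assms in \<open>auto intro: lunit_iso\<close>)

text \<open>Precomposing the transpose of \<open>g\<close> with the inverse of \<open>lunit\<close>
  strips off the unit object. Together with \<open>name_arr_inject\<close>, arrows A -> B are in
  bijection with points of \<open>ihom X A B\<close>, which is what makes \<open>EArr\<close> well
  defined.\<close>

lemma name_arr_surj:
  assumes "g \<in> Arr X" "Dom X g = unit X" "Cod X g = ihom X A B" "A \<in> Obj X" "B \<in> Obj X"
  obtains f where "f \<in> Arr X" "Dom X f = A" "Cod X f = B" "name_arr X f = g"
proof -
  obtain l where l: "l \<in> Arr X" "Dom X l = A" "Cod X l = unit X \<boxtimes> A"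
      "l \<cdot> lunit X A = Id X (unit X \<boxtimes> A)"
    using iso_arrD[OF lunit_iso[OF assms(4)]] assms(4) by auto
  let ?f = "untransp X A B g \<cdot> l"
  have "name_arr X ?f = g"
    by (rule untransp_inject[of A B]) (use l assms in \<open>auto simp: untransp_name_arr\<close>)
  then show ?thesis
    using l assms that[of ?f] by simp
qed

lemma ihom_pre_name:
  assumes "f \<in> Arr X" "g \<in> Arr X" "Dom X g = Cod X f" "B = Cod X g"
  shows "ihom_pre X f B \<cdot> name_arr X g = name_arr X (g \<cdot> f)"
proof (rule untransp_inject[of "Dom X f" B])
  have "untransp X (Dom X f) B (ihom_pre X f B \<cdot> name_arr X g) =
      (g \<cdot> lunit X (Cod X f)) \<cdot> (Id X (unit X) \<boxdot> f)"
    using assms by (simp add: untransp_ihom_pre untransp_name_arr)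
  then show "untransp X (Dom X f) B (ihom_pre X f B \<cdot> name_arr X g) =
      untransp X (Dom X f) B (name_arr X (g \<cdot> f))"
    using assms by (simp add: untransp_name_arr lunit_natural')
qed (use assms in auto)

lemma ihom_post_name:
  assumes "f \<in> Arr X" "g \<in> Arr X" "Dom X g = Cod X f" "A = Dom X f"
  shows "ihom_post X A g \<cdot> name_arr X f = name_arr X (g \<cdot> f)"
  by (rule untransp_inject[of A "Cod X g"])
    (use assms in \<open>auto simp: untransp_ihom_post untransp_name_arr\<close>)

section \<open>Enriched composition with one factor restricted to a point\<close>

lemma ihom_comp_simps [simp]:
  assumes "A \<in> Obj X" "B \<in> Obj X" "D \<in> Obj X"
  shows "ihom_comp X A B D \<in> Arr X" "Dom X (ihom_comp X A B D) = ihom X B D \<boxtimes> ihom X A B"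
    "Cod X (ihom_comp X A B D) = ihom X A D"
    "untransp X A D (ihom_comp X A B D) = evl X B D \<cdot> (Id X (ihom X B D) \<boxdot> evl X A B)
          \<cdot> assoc X (ihom X B D) (ihom X A B) A"
  using assms by (simp_all add: ihom_comp_def)

text \<open>The functor axiom \<open>EStr_comp\<close> mentions only \<open>ihom_comp\<close>; this
  identity lets it speak about postcomposition with a single arrow, whose name is inserted in the
  left factor. The unit object then stands leftmost, which is where the derived coherence
  \<open>lunit_tens\<close> enters.\<close>

lemma ihom_post_eq_ihom_comp:
  assumes g: "g \<in> Arr X" and A: "A \<in> Obj X"
  shows "ihom_post X A g \<cdot> lunit X (ihom X A (Dom X g)) =
    ihom_comp X A (Dom X g) (Cod X g) \<cdot> (name_arr X g \<boxdot> Id X (ihom X A (Dom X g)))"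
    (is "?l = ?r")
proof (rule untransp_inject[of A "Cod X g"])
  let ?B = "Dom X g" and ?D = "Cod X g"
  let ?H = "ihom X A ?B"
  have "untransp X A ?D ?r =
      evl X ?B ?D \<cdot> (Id X (ihom X ?B ?D) \<boxdot> evl X A ?B) \<cdot> assoc X (ihom X ?B ?D) ?H A
        \<cdot> ((name_arr X g \<boxdot> Id X ?H) \<boxdot> Id X A)"
    using g A by (simp add: untransp_Comp)
  also have "\<dots> = evl X ?B ?D \<cdot> (Id X (ihom X ?B ?D) \<boxdot> evl X A ?B) \<cdot>
        (name_arr X g \<boxdot> (Id X ?H \<boxdot> Id X A)) \<cdot> assoc X (unit X) ?H A"
    using assoc_natural'[of "name_arr X g" "Id X ?H" "Id X A"] g A by (simp del: tensa_Id)
  also have "\<dots> = (evl X ?B ?D \<cdot> (name_arr X g \<boxdot> Id X ?B)) \<cdot> (Id X (unit X) \<boxdot> evl X A ?B)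
        \<cdot> assoc X (unit X) ?H A"
    using g A by simp
  also have "\<dots> = (g \<cdot> lunit X ?B) \<cdot> (Id X (unit X) \<boxdot> evl X A ?B) \<cdot> assoc X (unit X) ?H A"
    using untransp_name_arr[OF g refl refl] by (simp add: untransp_def)
  also have "\<dots> = g \<cdot> (lunit X ?B \<cdot> (Id X (unit X) \<boxdot> evl X A ?B)) \<cdot> assoc X (unit X) ?H A"
    using g A by simp
  also have "lunit X ?B \<cdot> (Id X (unit X) \<boxdot> evl X A ?B) = evl X A ?B \<cdot> lunit X (?H \<boxtimes> A)"
    using lunit_natural'[of "evl X A ?B"] g A by simp
  also have "g \<cdot> (evl X A ?B \<cdot> lunit X (?H \<boxtimes> A)) \<cdot> assoc X (unit X) ?H A =
      g \<cdot> evl X A ?B \<cdot> (lunit X ?H \<boxdot> Id X A)"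
    using lunit_tens[of ?H A] g A by simp
  also have "\<dots> = untransp X A ?D ?l"
    using g A untransp_ihom_post[OF g A, of "lunit X ?H" ?D] by (simp add: untransp_def)
  finally show "untransp X A ?D ?l = untransp X A ?D ?r" by simp
qed (use assms in auto)

text \<open>Precomposition inserts the name in the right factor, so the unit object stands between
  the two others and the triangle axiom applies as it is.\<close>

lemma ihom_pre_eq_ihom_comp:
  assumes f: "f \<in> Arr X" and D: "D \<in> Obj X"
  shows "ihom_pre X f D \<cdot> runit X (ihom X (Cod X f) D) =
    ihom_comp X (Dom X f) (Cod X f) D \<cdot> (Id X (ihom X (Cod X f) D) \<boxdot> name_arr X f)"
    (is "?l = ?r")
proof (rule untransp_inject[of "Dom X f" D])
  let ?A = "Dom X f" and ?B = "Cod X f"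
  let ?H = "ihom X ?B D"
  have "untransp X ?A D ?r = evl X ?B D \<cdot> (Id X ?H \<boxdot> evl X ?A ?B) \<cdot> assoc X ?H (ihom X ?A ?B) ?A
        \<cdot> ((Id X ?H \<boxdot> name_arr X f) \<boxdot> Id X ?A)"
    using f D by (simp add: untransp_Comp)
  also have "\<dots> = evl X ?B D \<cdot> (Id X ?H \<boxdot> evl X ?A ?B) \<cdot>
        (Id X ?H \<boxdot> (name_arr X f \<boxdot> Id X ?A)) \<cdot> assoc X ?H (unit X) ?A"
    using assoc_natural'[of "Id X ?H" "name_arr X f" "Id X ?A"] f D by (simp del: tensa_Id)
  also have "\<dots> = evl X ?B D \<cdot> (Id X ?H \<boxdot> (f \<cdot> lunit X ?A)) \<cdot> assoc X ?H (unit X) ?A"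
    using f D untransp_name_arr[OF f refl refl] by (simp add: untransp_def)
  also have "\<dots> = evl X ?B D \<cdot> (Id X ?H \<boxdot> f) \<cdot> (Id X ?H \<boxdot> lunit X ?A) \<cdot> assoc X ?H (unit X) ?A"
    using f D by simp
  also have "\<dots> = evl X ?B D \<cdot> (Id X ?H \<boxdot> f) \<cdot> (runit X ?H \<boxdot> Id X ?A)"
    using triangle[of ?H ?A] f D by simp
  also have "\<dots> = untransp X ?A D ?l"
    using f D untransp_ihom_pre[OF f D, of "runit X ?H" ?A] by (simp add: untransp_def)
  finally show "untransp X ?A D ?l = untransp X ?A D ?r" by simp
qed (use assms in auto)

end

section \<open>Enriched monads and their strengths\<close>

context enriched_monad
begin

lemma EObj_simps [simp]: "A \<in> Obj X \<Longrightarrow> EObj L A \<in> Obj X"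
  by (rule EObj_in)

lemma EStr_simps [simp]:
  assumes "A \<in> Obj X" "B \<in> Obj X"
  shows "EStr L A B \<in> Arr X" "Dom X (EStr L A B) = ihom X A B"
    "Cod X (EStr L A B) = ihom X (EObj L A) (EObj L B)"
  using EStr_in[OF assms] by (auto simp: in_hom_iff)

lemma EUnit_simps [simp]:
  assumes "A \<in> Obj X"
  shows "EUnit L A \<in> Arr X" "Dom X (EUnit L A) = A" "Cod X (EUnit L A) = EObj L A"
  using EUnit_in[OF assms] by (auto simp: in_hom_iff)

lemma EMult_simps [simp]:
  assumes "A \<in> Obj X"
  shows "EMult L A \<in> Arr X" "Dom X (EMult L A) = EObj L (EObj L A)" "Cod X (EMult L A) = EObj L A"
  using EMult_in[OF assms] by (auto simp: in_hom_iff)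

text \<open>\<open>EStr\<close> sends the name of \<open>f\<close> to a point of the hom-object
  between the images, and each such point names exactly one arrow; hence the description defining
  \<open>EArr\<close> denotes.\<close>

lemma EArr_props:
  assumes "f \<in> Arr X"
  shows "EArr X L f \<in> hom X (EObj L (Dom X f)) (EObj L (Cod X f)) \<and>
    name_arr X (EArr X L f) = EStr L (Dom X f) (Cod X f) \<cdot> name_arr X f"
proof -
  let ?P = "\<lambda>g. g \<in> hom X (EObj L (Dom X f)) (EObj L (Cod X f)) \<and>
    name_arr X g = EStr L (Dom X f) (Cod X f) \<cdot> name_arr X f"
  obtain g where "?P g"
    using assms name_arr_surj[of "EStr L (Dom X f) (Cod X f) \<cdot> name_arr X f"
        "EObj L (Dom X f)" "EObj L (Cod X f)"] by (auto simp: in_hom_iff)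
  then have "\<exists>!g. ?P g"
    using name_arr_inject by (auto simp: in_hom_iff intro!: ex1I[of _ g])
  from theI'[OF this] show ?thesis
    unfolding EArr_def by blast
qed

lemma EArr_simps [simp]:
  assumes "f \<in> Arr X"
  shows "EArr X L f \<in> Arr X" "Dom X (EArr X L f) = EObj L (Dom X f)"
    "Cod X (EArr X L f) = EObj L (Cod X f)"
  using EArr_props[OF assms] by (auto simp: in_hom_iff)

lemma name_arr_EArr:
  "f \<in> Arr X \<Longrightarrow> name_arr X (EArr X L f) = EStr L (Dom X f) (Cod X f) \<cdot> name_arr X f"
  using EArr_props by blast

lemma EArr_Id [simp]:
  assumes "A \<in> Obj X"
  shows "EArr X L (Id X A) = Id X (EObj L A)"
  by (rule name_arr_inject)
    (use assms in \<open>auto simp: name_arr_EArr name_arr_Id EStr_id\<close>)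

text \<open>This is the composition axiom with the name of \<open>g\<close> put in the left factor;
  the invertible \<open>lunit\<close> is cancelled.\<close>

lemma EStr_ihom_post:
  assumes g: "g \<in> Arr X" and A: "A \<in> Obj X"
  shows "EStr L A (Cod X g) \<cdot> ihom_post X A g =
    ihom_post X (EObj L A) (EArr X L g) \<cdot> EStr L A (Dom X g)"
proof (rule iso_epic)
  let ?B = "Dom X g" and ?D = "Cod X g"
  let ?H = "ihom X A ?B" and ?A = "EObj L A"
  have "(EStr L A ?D \<cdot> ihom_post X A g) \<cdot> lunit X ?H =
      (EStr L A ?D \<cdot> ihom_comp X A ?B ?D) \<cdot> (name_arr X g \<boxdot> Id X ?H)"
    using g A by (simp add: ihom_post_eq_ihom_comp)
  also have "\<dots> = ihom_comp X ?A (EObj L ?B) (EObj L ?D) \<cdot>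
      (name_arr X (EArr X L g) \<boxdot> EStr L A ?B)"
    using g A by (simp add: EStr_comp name_arr_EArr)
  also have "\<dots> = (ihom_comp X ?A (EObj L ?B) (EObj L ?D) \<cdot>
      (name_arr X (EArr X L g) \<boxdot> Id X (ihom X ?A (EObj L ?B)))) \<cdot> (Id X (unit X) \<boxdot> EStr L A ?B)"
    using g A by simp
  also have "\<dots> = (ihom_post X ?A (EArr X L g) \<cdot> lunit X (ihom X ?A (EObj L ?B))) \<cdot>
      (Id X (unit X) \<boxdot> EStr L A ?B)"
    using g A ihom_post_eq_ihom_comp[of "EArr X L g" ?A] by simp
  also have "\<dots> = (ihom_post X ?A (EArr X L g) \<cdot> EStr L A ?B) \<cdot> lunit X ?H"
    using g A lunit_natural'[of "EStr L A ?B"] by simp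
  finally show "(EStr L A ?D \<cdot> ihom_post X A g) \<cdot> lunit X ?H =
    (ihom_post X ?A (EArr X L g) \<cdot> EStr L A ?B) \<cdot> lunit X ?H" .
qed (use g A in \<open>auto intro: lunit_iso\<close>)

lemma EStr_ihom_pre:
  assumes f: "f \<in> Arr X" and D: "D \<in> Obj X"
  shows "EStr L (Dom X f) D \<cdot> ihom_pre X f D =
    ihom_pre X (EArr X L f) (EObj L D) \<cdot> EStr L (Cod X f) D"
proof (rule iso_epic)
  let ?A = "Dom X f" and ?B = "Cod X f"
  let ?H = "ihom X ?B D" and ?D = "EObj L D"
  have "(EStr L ?A D \<cdot> ihom_pre X f D) \<cdot> runit X ?H =
      (EStr L ?A D \<cdot> ihom_comp X ?A ?B D) \<cdot> (Id X ?H \<boxdot> name_arr X f)"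
    using f D by (simp add: ihom_pre_eq_ihom_comp)
  also have "\<dots> = ihom_comp X (EObj L ?A) (EObj L ?B) ?D \<cdot>
      (EStr L ?B D \<boxdot> name_arr X (EArr X L f))"
    using f D by (simp add: EStr_comp name_arr_EArr)
  also have "\<dots> = (ihom_comp X (EObj L ?A) (EObj L ?B) ?D \<cdot>
      (Id X (ihom X (EObj L ?B) ?D) \<boxdot> name_arr X (EArr X L f))) \<cdot> (EStr L ?B D \<boxdot> Id X (unit X))"
    using f D by simp
  also have "\<dots> = (ihom_pre X (EArr X L f) ?D \<cdot> runit X (ihom X (EObj L ?B) ?D)) \<cdot>
      (EStr L ?B D \<boxdot> Id X (unit X))"
    using f D ihom_pre_eq_ihom_comp[of "EArr X L f" ?D] by simp
  also have "\<dots> = (ihom_pre X (EArr X L f) ?D \<cdot> EStr L ?B D) \<cdot> runit X ?H"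
    using f D runit_natural[of "EStr L ?B D"] by (simp add: in_hom_iff)
  finally show "(EStr L ?A D \<cdot> ihom_pre X f D) \<cdot> runit X ?H =
    (ihom_pre X (EArr X L f) ?D \<cdot> EStr L ?B D) \<cdot> runit X ?H" .
qed (use f D in \<open>auto intro: runit_iso\<close>)

lemma EArr_Comp:
  assumes "f \<in> Arr X" "g \<in> Arr X" "Dom X g = Cod X f"
  shows "EArr X L (g \<cdot> f) = EArr X L g \<cdot> EArr X L f"
proof (rule name_arr_inject)
  have "name_arr X (EArr X L (g \<cdot> f)) =
      (EStr L (Dom X f) (Cod X g) \<cdot> ihom_post X (Dom X f) g) \<cdot> name_arr X f"
    using assms by (simp add: name_arr_EArr ihom_post_name)
  also have "\<dots> = ihom_post X (EObj L (Dom X f)) (EArr X L g) \<cdot> name_arr X (EArr X L f)"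
    using assms by (simp add: EStr_ihom_post name_arr_EArr)
  also have "\<dots> = name_arr X (EArr X L g \<cdot> EArr X L f)"
    using assms by (intro ihom_post_name) auto
  finally show "name_arr X (EArr X L (g \<cdot> f)) = name_arr X (EArr X L g \<cdot> EArr X L f)" .
qed (use assms in auto)

lemma EUnit_EArr:
  assumes f: "f \<in> Arr X"
  shows "EUnit L (Cod X f) \<cdot> f = EArr X L f \<cdot> EUnit L (Dom X f)"
proof (rule name_arr_inject)
  let ?A = "Dom X f" and ?B = "Cod X f"
  have "name_arr X (EUnit L ?B \<cdot> f) = ihom_post X ?A (EUnit L ?B) \<cdot> name_arr X f"
    using f by (intro ihom_post_name[symmetric]) auto
  also have "\<dots> = ihom_pre X (EUnit L ?A) (EObj L ?B) \<cdot> name_arr X (EArr X L f)"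
    using f by (simp add: EUnit_natural name_arr_EArr)
  also have "\<dots> = name_arr X (EArr X L f \<cdot> EUnit L ?A)"
    using f by (intro ihom_pre_name) auto
  finally show "name_arr X (EUnit L ?B \<cdot> f) = name_arr X (EArr X L f \<cdot> EUnit L ?A)" .
qed (use f in auto)

lemma EMult_EArr:
  assumes f: "f \<in> Arr X"
  shows "EMult L (Cod X f) \<cdot> EArr X L (EArr X L f) = EArr X L f \<cdot> EMult L (Dom X f)"
proof (rule name_arr_inject)
  let ?A = "Dom X f" and ?B = "Cod X f"
  have "name_arr X (EMult L ?B \<cdot> EArr X L (EArr X L f)) =
      ihom_post X (EObj L (EObj L ?A)) (EMult L ?B) \<cdot> name_arr X (EArr X L (EArr X L f))"
    using f by (intro ihom_post_name[symmetric]) auto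
  also have "\<dots> = (ihom_post X (EObj L (EObj L ?A)) (EMult L ?B) \<cdot>
      EStr L (EObj L ?A) (EObj L ?B) \<cdot> EStr L ?A ?B) \<cdot> name_arr X f"
    using f by (simp add: name_arr_EArr)
  also have "\<dots> = ihom_pre X (EMult L ?A) (EObj L ?B) \<cdot> name_arr X (EArr X L f)"
    using f by (simp add: EMult_natural name_arr_EArr)
  also have "\<dots> = name_arr X (EArr X L f \<cdot> EMult L ?A)"
    using f by (intro ihom_pre_name) auto
  finally show "name_arr X (EMult L ?B \<cdot> EArr X L (EArr X L f)) =
    name_arr X (EArr X L f \<cdot> EMult L ?A)" .
qed (use f in auto)

section \<open>Strengths of the monad\<close>

lemma rstrength_simps [simp]:
  assumes "A \<in> Obj X" "B \<in> Obj X"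
  shows "rstrength X L A B \<in> Arr X" "Dom X (rstrength X L A B) = A \<boxtimes> EObj L B"
    "Cod X (rstrength X L A B) = EObj L (A \<boxtimes> B)"
  using assms by (simp_all add: rstrength_def)

text \<open>Every \<open>g\<close> into \<open>ihom X A B\<close> factors as a coevaluation
  (\<open>?c\<close> below) followed by postcomposition with its transpose. Naturality of
  \<open>EStr\<close> moves the transpose out, and what remains is the strength by definition. Later
  questions about \<open>EStr\<close> thereby become questions about
  \<open>rstrength\<close>.\<close>

lemma untransp_EStr:
  assumes g: "g \<in> Arr X" "Cod X g = ihom X A B" and A: "A \<in> Obj X" and B: "B \<in> Obj X"
  shows "untransp X (EObj L A) (EObj L B) (EStr L A B \<cdot> g) =
    EArr X L (untransp X A B g) \<cdot> rstrength X L (Dom X g) A"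
proof -
  let ?Z = "Dom X g" and ?h = "untransp X A B g"
  let ?c = "transp X ?Z A (?Z \<boxtimes> A) (Id X (?Z \<boxtimes> A))"
  have "g = ihom_post X A ?h \<cdot> ?c"
    by (rule untransp_inject[of A B]) (use g A B in \<open>auto simp: untransp_ihom_post\<close>)
  then have "EStr L A B \<cdot> g = EStr L A (Cod X ?h) \<cdot> ihom_post X A ?h \<cdot> ?c"
    using g A B by simp
  also have "\<dots> = (EStr L A (Cod X ?h) \<cdot> ihom_post X A ?h) \<cdot> ?c"
    using g A B by simp
  also have "\<dots> = ihom_post X (EObj L A) (EArr X L ?h) \<cdot> EStr L A (?Z \<boxtimes> A) \<cdot> ?c"
    using g A B EStr_ihom_post[of ?h A] by simp
  finally show ?thesis
    using g A B by (simp add: untransp_ihom_post rstrength_def)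
qed

lemma rstrength_natural_left:
  assumes f: "f \<in> Arr X" and B: "B \<in> Obj X"
  shows "rstrength X L (Cod X f) B \<cdot> (f \<boxdot> Id X (EObj L B)) =
    EArr X L (f \<boxdot> Id X B) \<cdot> rstrength X L (Dom X f) B"
proof -
  let ?A = "Cod X f"
  let ?c = "transp X ?A B (?A \<boxtimes> B) (Id X (?A \<boxtimes> B))"
  have "rstrength X L ?A B \<cdot> (f \<boxdot> Id X (EObj L B)) =
      untransp X (EObj L B) (EObj L (?A \<boxtimes> B)) (EStr L B (?A \<boxtimes> B) \<cdot> ?c \<cdot> f)"
    using f B untransp_Comp[of "EObj L B" "EObj L (?A \<boxtimes> B)" "EStr L B (?A \<boxtimes> B) \<cdot> ?c" f]
    by (simp add: rstrength_def)
  also have "\<dots> = EArr X L (untransp X B (?A \<boxtimes> B) (?c \<cdot> f)) \<cdot> rstrength X L (Dom X f) B"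
    using f B untransp_EStr[of "?c \<cdot> f"] by simp
  finally show ?thesis
    using f B by (simp add: untransp_Comp)
qed

text \<open>Precomposing with \<open>EArr X L g\<close> in the second variable amounts to
  \<open>ihom_pre\<close> on the transpose, so the claim reduces to naturality of
  \<open>EStr\<close> in its first argument.\<close>

lemma rstrength_natural_right:
  assumes A: "A \<in> Obj X" and g: "g \<in> Arr X"
  shows "rstrength X L A (Cod X g) \<cdot> (Id X A \<boxdot> EArr X L g) =
    EArr X L (Id X A \<boxdot> g) \<cdot> rstrength X L A (Dom X g)"
proof -
  let ?B = "Dom X g" and ?B' = "Cod X g"
  let ?c = "transp X A ?B' (A \<boxtimes> ?B') (Id X (A \<boxtimes> ?B'))"
  have "rstrength X L A ?B' \<cdot> (Id X A \<boxdot> EArr X L g) =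
      untransp X (EObj L ?B) (EObj L (A \<boxtimes> ?B'))
        (ihom_pre X (EArr X L g) (EObj L (A \<boxtimes> ?B')) \<cdot> EStr L ?B' (A \<boxtimes> ?B') \<cdot> ?c)"
    using A g by (simp add: untransp_ihom_pre rstrength_def)
  also have "ihom_pre X (EArr X L g) (EObj L (A \<boxtimes> ?B')) \<cdot> EStr L ?B' (A \<boxtimes> ?B') \<cdot> ?c =
      (EStr L ?B (A \<boxtimes> ?B') \<cdot> ihom_pre X g (A \<boxtimes> ?B')) \<cdot> ?c"
    unfolding EStr_ihom_pre[OF g tens_in[OF A Cod_in[OF g]]] using A g by simp
  also have "untransp X (EObj L ?B) (EObj L (A \<boxtimes> ?B')) \<dots> =
      EArr X L (untransp X ?B (A \<boxtimes> ?B') (ihom_pre X g (A \<boxtimes> ?B') \<cdot> ?c)) \<cdot> rstrength X L A ?B"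
    using A g untransp_EStr[of "ihom_pre X g (A \<boxtimes> ?B') \<cdot> ?c"] by simp
  finally show ?thesis
    using A g by (simp add: untransp_ihom_pre)
qed

lemma lstrength_eq:
  assumes "A \<in> Obj X" "B \<in> Obj X"
  shows "lstrength X L A B = EArr X L (symm X B A) \<cdot> rstrength X L B A \<cdot> symm X (EObj L A) B"
  using assms by (simp add: lstrength_def untransp_EStr)

lemma lstrength_simps [simp]:
  assumes "A \<in> Obj X" "B \<in> Obj X"
  shows "lstrength X L A B \<in> Arr X" "Dom X (lstrength X L A B) = EObj L A \<boxtimes> B"
    "Cod X (lstrength X L A B) = EObj L (A \<boxtimes> B)"
  using assms by (simp_all add: lstrength_eq)

lemma lstrength_natural_right:
  assumes A: "A \<in> Obj X" and g: "g \<in> Arr X"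
  shows "lstrength X L A (Cod X g) \<cdot> (Id X (EObj L A) \<boxdot> g) =
    EArr X L (Id X A \<boxdot> g) \<cdot> lstrength X L A (Dom X g)"
proof -
  let ?B = "Dom X g" and ?B' = "Cod X g"
  have "lstrength X L A ?B' \<cdot> (Id X (EObj L A) \<boxdot> g) =
      EArr X L (symm X ?B' A) \<cdot> rstrength X L ?B' A \<cdot> symm X (EObj L A) ?B' \<cdot> (Id X (EObj L A) \<boxdot> g)"
    using A g by (simp add: lstrength_eq)
  also have "\<dots> = EArr X L (symm X ?B' A) \<cdot> (rstrength X L ?B' A \<cdot> (g \<boxdot> Id X (EObj L A))) \<cdot>
      symm X (EObj L A) ?B"
    using A g symm_natural'[of "Id X (EObj L A)" g] by simp
  also have "\<dots> = EArr X L (symm X ?B' A \<cdot> (g \<boxdot> Id X A)) \<cdot> rstrength X L ?B A \<cdot> symm X (EObj L A) ?B"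
    using A g by (simp add: rstrength_natural_left EArr_Comp)
  also have "symm X ?B' A \<cdot> (g \<boxdot> Id X A) = (Id X A \<boxdot> g) \<cdot> symm X ?B A"
    using A g symm_natural'[of g "Id X A"] by simp
  finally show ?thesis
    using A g by (simp add: lstrength_eq EArr_Comp)
qed

lemma lstrength_symm:
  assumes "A \<in> Obj X" "B \<in> Obj X"
  shows "lstrength X L A B \<cdot> symm X B (EObj L A) = EArr X L (symm X B A) \<cdot> rstrength X L B A"
  using assms by (simp add: lstrength_eq symm_symm)

end

section \<open>Internal homs of linear spaces\<close>

lemma (in category) equalizer_of_finite_limits:
  assumes lim: "has_finite_limits C"
    and f: "f \<in> Arr C" and g: "g \<in> Arr C" and fg: "Dom C f = Dom C g" "Cod C f = Cod C g"
  shows "\<exists>u. is_equalizer C f g u"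
proof -
  \<comment> \<open>The parallel pair: the objects 0 and 1 share their numbers with their
    identities, and the arrows 2 and 3 go from 0 to 1. One factor of a composite is always an
    identity.\<close>
  define J :: "(nat, nat) category" where
    "J = \<lparr>Obj = {0, 1}, Arr = {0, 1, 2, 3}, Dom = (\<lambda>a. if a = 1 then 1 else 0),
      Cod = (\<lambda>a. if a = 0 then 0 else 1), Id = (\<lambda>a. a),
      Comp = (\<lambda>b a. if b = 0 \<or> b = 1 then a else b)\<rparr>"
  define Fo where "Fo = (\<lambda>j :: nat. if j = 0 then Dom C f else Cod C f)"
  define Fa where "Fa = (\<lambda>a :: nat. if a = 0 then Id C (Dom C f) else
    if a = 1 then Id C (Cod C f) else if a = 2 then f else g)"
  have "category J"
  proof
    show "(h \<cdot>\<^bsub>J\<^esub> g) \<cdot>\<^bsub>J\<^esub> k = h \<cdot>\<^bsub>J\<^esub> g \<cdot>\<^bsub>J\<^esub> k" for h g k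
      by (simp add: J_def)
  qed (auto simp: J_def hom_def)
  moreover have "is_functor J C Fo Fa"
    using f g fg by (simp add: is_functor_def J_def Fo_def Fa_def in_hom_iff split del: if_split)
  moreover have "finite (Obj J)" "finite (Arr J)"
    by (simp_all add: J_def)
  ultimately obtain P p where P: "is_limit_cone J C Fo Fa P p"
    using lim unfolding has_finite_limits_def by blast
  have cone: "is_cone J C Fo Fa Z q \<longleftrightarrow> Z \<in> Obj C \<and> q 0 \<in> hom C Z (Dom C f) \<and>
      q 1 = f \<cdot> q 0 \<and> q 1 = g \<cdot> q 0" for Z q
    using f g fg by (auto simp: is_cone_def J_def Fo_def Fa_def in_hom_iff)
  have p: "P \<in> Obj C" "p 0 \<in> hom C P (Dom C f)" "p 1 = f \<cdot> p 0" "p 1 = g \<cdot> p 0"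
    using P by (auto simp: is_limit_cone_def cone)
  have "\<exists>!t. t \<in> hom C Z P \<and> p 0 \<cdot> t = z"
    if Z: "Z \<in> Obj C" "z \<in> hom C Z (Dom C f)" "f \<cdot> z = g \<cdot> z" for Z z
  proof -
    define q where "q = (\<lambda>j :: nat. if j = 0 then z else f \<cdot> z)"
    have "is_cone J C Fo Fa Z q"
      using Z by (simp add: cone q_def)
    then have "\<exists>!t. t \<in> hom C Z P \<and> (\<forall>j\<in>Obj J. p j \<cdot> t = q j)"
      using P by (auto simp: is_limit_cone_def)
    moreover have "(\<forall>j\<in>Obj J. p j \<cdot> t = q j) \<longleftrightarrow> p 0 \<cdot> t = z" if "t \<in> hom C Z P" for t
    proof -
      have "p 1 \<cdot> t = f \<cdot> p 0 \<cdot> t"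
        unfolding p(3) using that p(2) f by (simp add: in_hom_iff)
      then show ?thesis
        by (auto simp: J_def q_def)
    qed
    ultimately show ?thesis by metis
  qed
  moreover have "p 0 \<in> Arr C" "Cod C (p 0) = Dom C f" "Dom C (p 0) = P" "f \<cdot> p 0 = g \<cdot> p 0"
    using p by (simp_all add: in_hom_iff)
  ultimately have "is_equalizer C f g (p 0)"
    by (simp add: is_equalizer_def)
  then show ?thesis ..
qed

locale linear_spaces = commutative_monad X L
  for X :: "('o, 'm, 'x) smc_category_scheme" (structure)
  and L :: "('o, 'm) enriched_monad" +
  assumes finite_limits: "has_finite_limits X"
begin

text \<open>Algebras of the mere endofunctor suffice for the construction of internal homs, so that
  \<open>dual X L E\<close> need not be shown to satisfy the algebra laws.\<close>

definition functor_algebra :: "('o, 'm) alg \<Rightarrow> bool" where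
  "functor_algebra A \<longleftrightarrow> fst A \<in> Obj X \<and> snd A \<in> hom X (EObj L (fst A)) (fst A)"

lemma functor_algebra_simps [simp]:
  assumes "functor_algebra A"
  shows "fst A \<in> Obj X" "snd A \<in> Arr X" "Dom X (snd A) = EObj L (fst A)" "Cod X (snd A) = fst A"
  using assms by (auto simp: functor_algebra_def in_hom_iff)

lemma linear_space_iff:
  "linear_space X L A \<longleftrightarrow> functor_algebra A \<and> snd A \<cdot> EUnit L (fst A) = Id X (fst A) \<and>
    snd A \<cdot> EMult L (fst A) = snd A \<cdot> EArr X L (snd A)"
  by (auto simp: EM_def is_algebra_def ordinary_def functor_algebra_def)

lemma linear_space_functor_algebra [simp]: "linear_space X L A \<Longrightarrow> functor_algebra A"
  by (simp add: linear_space_iff)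

text \<open>The transposed form of the equation that \<open>em_hom\<close> equalizes, as
  \<open>equalizes_iff\<close> shows. The parameter \<open>Z\<close> is a bare object, so that the
  hom-object can be tested by arrows from every object of X.\<close>

definition linear_right :: "('o, 'm) alg \<Rightarrow> ('o, 'm) alg \<Rightarrow> 'o \<Rightarrow> 'm \<Rightarrow> bool" where
  "linear_right A B Z f \<longleftrightarrow>
    f \<cdot> (Id X Z \<boxdot> snd A) = snd B \<cdot> EArr X L f \<cdot> rstrength X L Z (fst A)"

definition linear_left :: "('o, 'm) alg \<Rightarrow> ('o, 'm) alg \<Rightarrow> 'o \<Rightarrow> 'm \<Rightarrow> bool" where
  "linear_left A B Z f \<longleftrightarrow>
    f \<cdot> (snd A \<boxdot> Id X Z) = snd B \<cdot> EArr X L f \<cdot> lstrength X L (fst A) Z"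

lemma linear_right_Comp:
  assumes A: "functor_algebra A" and B: "functor_algebra B"
    and f: "f \<in> Arr X" "Dom X f = Z \<boxtimes> fst A" "Cod X f = fst B" "Z \<in> Obj X"
    and lin: "linear_right A B Z f"
    and t: "t \<in> Arr X" "Cod X t = Z"
  shows "linear_right A B (Dom X t) (f \<cdot> (t \<boxdot> Id X (fst A)))"
proof -
  have "(f \<cdot> (t \<boxdot> Id X (fst A))) \<cdot> (Id X (Dom X t) \<boxdot> snd A) =
      (f \<cdot> (Id X Z \<boxdot> snd A)) \<cdot> (t \<boxdot> Id X (EObj L (fst A)))"
    using assms by simp
  also have "\<dots> = snd B \<cdot> EArr X L f \<cdot> rstrength X L Z (fst A) \<cdot> (t \<boxdot> Id X (EObj L (fst A)))"
    unfolding lin[unfolded linear_right_def] using assms(1-6) t by simp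
  also have "\<dots> = snd B \<cdot> EArr X L (f \<cdot> (t \<boxdot> Id X (fst A))) \<cdot> rstrength X L (Dom X t) (fst A)"
    using assms(1-6) t rstrength_natural_left[of t "fst A"] by (simp add: EArr_Comp)
  finally show ?thesis
    by (simp add: linear_right_def)
qed

lemma em_hom_equalizer:
  assumes "functor_algebra A" "functor_algebra B"
  shows "is_equalizer X (ihom_pre X (snd A) (fst B))
    (ihom_post X (EObj L (fst A)) (snd B) \<cdot> EStr L (fst A) (fst B)) (em_hom X L A B)"
  unfolding em_hom_def
  by (rule someI_ex, rule equalizer_of_finite_limits[OF finite_limits]) (use assms in auto)

lemma em_hom_simps [simp]:
  assumes "functor_algebra A" "functor_algebra B"
  shows "em_hom X L A B \<in> Arr X" "Cod X (em_hom X L A B) = ihom X (fst A) (fst B)"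
    "Dom X (em_hom X L A B) = fst (lin_hom X L A B)" "fst (lin_hom X L A B) \<in> Obj X"
  using em_hom_equalizer[OF assms] assms Dom_Obj[of "em_hom X L A B"]
  by (auto simp: is_equalizer_def lin_hom_def Let_def)

lemma em_eval_simps [simp]:
  assumes "functor_algebra A" "functor_algebra B"
  shows "em_eval X L A B \<in> Arr X" "Dom X (em_eval X L A B) = fst (lin_hom X L A B) \<boxtimes> fst A"
    "Cod X (em_eval X L A B) = fst B"
  using assms by (simp_all add: em_eval_def)

text \<open>Transposition is injective. It sends the first composite to precomposition with the
  structure of \<open>A\<close> and, by \<open>untransp_EStr\<close>, the second to the side of
  \<open>linear_right\<close> that contains the strength.\<close>

lemma equalizes_iff:
  assumes A: "functor_algebra A" and B: "functor_algebra B"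
    and g: "g \<in> Arr X" "Cod X g = ihom X (fst A) (fst B)"
  shows "ihom_pre X (snd A) (fst B) \<cdot> g =
      (ihom_post X (EObj L (fst A)) (snd B) \<cdot> EStr L (fst A) (fst B)) \<cdot> g \<longleftrightarrow>
    linear_right A B (Dom X g) (untransp X (fst A) (fst B) g)" (is "?l = ?r \<longleftrightarrow> ?lin")
proof -
  let ?u = "untransp X (EObj L (fst A)) (fst B)"
  have "?u ?l = untransp X (fst A) (fst B) g \<cdot> (Id X (Dom X g) \<boxdot> snd A)"
    using assms by (simp add: untransp_ihom_pre)
  moreover have "?u ?r = snd B \<cdot> EArr X L (untransp X (fst A) (fst B) g) \<cdot>
      rstrength X L (Dom X g) (fst A)"
    using assms by (simp add: untransp_ihom_post untransp_EStr)
  moreover have "?l = ?r \<longleftrightarrow> ?u ?l = ?u ?r"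
    using assms untransp_inject[of "EObj L (fst A)" "fst B" ?l ?r] by auto
  ultimately show ?thesis
    by (simp add: linear_right_def)
qed

lemma em_eval_linear_right:
  assumes "functor_algebra A" "functor_algebra B"
  shows "linear_right A B (fst (lin_hom X L A B)) (em_eval X L A B)"
  using equalizes_iff[OF assms, of "em_hom X L A B"] em_hom_equalizer[OF assms] assms
  by (simp add: is_equalizer_def em_eval_def)

lemma em_hom_Comp_iff:
  assumes "functor_algebra A" "functor_algebra B"
    and "t \<in> Arr X" "Cod X t = fst (lin_hom X L A B)"
    and "g \<in> Arr X" "Cod X g = ihom X (fst A) (fst B)" "Dom X g = Dom X t"
  shows "em_hom X L A B \<cdot> t = g \<longleftrightarrow>
    em_eval X L A B \<cdot> (t \<boxdot> Id X (fst A)) = untransp X (fst A) (fst B) g"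
proof -
  have "em_eval X L A B \<cdot> (t \<boxdot> Id X (fst A)) = untransp X (fst A) (fst B) (em_hom X L A B \<cdot> t)"
    using assms by (simp add: em_eval_def untransp_Comp)
  then show ?thesis
    using assms untransp_inject[of "fst A" "fst B" "em_hom X L A B \<cdot> t" g] by auto
qed

text \<open>The equalizer property of \<open>em_hom\<close> read through transposition. It holds
  whichever equalizer \<open>SOME\<close> picked, and it produces the arrows denoted by the
  \<open>THE\<close> terms in \<open>lin_hom\<close>, \<open>dd_unit\<close> and
  \<open>lin_hom_pre\<close>.\<close>

lemma em_eval_universal:
  assumes A: "functor_algebra A" and B: "functor_algebra B"
    and f: "f \<in> Arr X" "Dom X f = Z \<boxtimes> fst A" "Cod X f = fst B" "Z \<in> Obj X"
    and lin: "linear_right A B Z f"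
  shows "\<exists>!t. t \<in> hom X Z (fst (lin_hom X L A B)) \<and> em_eval X L A B \<cdot> (t \<boxdot> Id X (fst A)) = f"
proof -
  let ?g = "transp X Z (fst A) (fst B) f"
  have "ihom_pre X (snd A) (fst B) \<cdot> ?g =
      (ihom_post X (EObj L (fst A)) (snd B) \<cdot> EStr L (fst A) (fst B)) \<cdot> ?g"
    using equalizes_iff[OF A B, of ?g] assms by simp
  then have "\<exists>!t. t \<in> hom X Z (fst (lin_hom X L A B)) \<and> em_hom X L A B \<cdot> t = ?g"
    using em_hom_equalizer[OF A B] assms by (simp add: is_equalizer_def in_hom_iff)
  moreover have "em_hom X L A B \<cdot> t = ?g \<longleftrightarrow> em_eval X L A B \<cdot> (t \<boxdot> Id X (fst A)) = f"
    if "t \<in> hom X Z (fst (lin_hom X L A B))" for t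
    using that assms em_hom_Comp_iff[OF A B, of t ?g] by (simp add: in_hom_iff)
  ultimately show ?thesis by metis
qed

lemma em_eval_cancel:
  assumes A: "functor_algebra A" and B: "functor_algebra B"
    and s: "s \<in> Arr X" "Cod X s = fst (lin_hom X L A B)"
    and t: "t \<in> Arr X" "Cod X t = fst (lin_hom X L A B)" "Dom X s = Dom X t"
    and eq: "em_eval X L A B \<cdot> (s \<boxdot> Id X (fst A)) = em_eval X L A B \<cdot> (t \<boxdot> Id X (fst A))"
  shows "s = t"
proof -
  have "linear_right A B (Dom X t) (em_eval X L A B \<cdot> (t \<boxdot> Id X (fst A)))"
    by (rule linear_right_Comp[OF A B _ _ _ _ em_eval_linear_right[OF A B]]) (use assms in auto)
  then have "\<exists>!z. z \<in> hom X (Dom X t) (fst (lin_hom X L A B)) \<and>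
      em_eval X L A B \<cdot> (z \<boxdot> Id X (fst A)) = em_eval X L A B \<cdot> (t \<boxdot> Id X (fst A))"
    using assms by (intro em_eval_universal) auto
  then show ?thesis
    using assms by (auto simp: in_hom_iff)
qed

text \<open>Commutativity of the monad is what makes the linear extension of evaluation in its first
  variable linear in the second variable.\<close>

lemma lin_hom_structure:
  assumes A: "functor_algebra A" and B: "linear_space X L B"
  shows "functor_algebra (lin_hom X L A B)"
    and "linear_left (lin_hom X L A B) B (fst A) (em_eval X L A B)"
proof -
  let ?P = "fst (lin_hom X L A B)" and ?a = "fst A" and ?e = "em_eval X L A B" and ?b = "snd B"
  let ?f = "?b \<cdot> EArr X L ?e \<cdot> lstrength X L ?P ?a"
  have B': "functor_algebra B"
    using B by simp
  note AB = em_hom_simps(4)[OF A B'] em_eval_simps[OF A B'] A B'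
  \<comment> \<open>Associativity of the structure of \<open>B\<close> and naturality of the
    multiplication merge two successive linear extensions into one. \<open>h\<close> is kept general
    because both strengths take its place.\<close>
  have ext: "?b \<cdot> EArr X L (?b \<cdot> EArr X L ?e \<cdot> h) =
      ?b \<cdot> EArr X L ?e \<cdot> EMult L (?P \<boxtimes> ?a) \<cdot> EArr X L h"
    if h: "h \<in> Arr X" "Cod X h = EObj L (?P \<boxtimes> ?a)" for h
  proof -
    have "?b \<cdot> EArr X L (?b \<cdot> EArr X L ?e \<cdot> h) =
        (?b \<cdot> EArr X L ?b) \<cdot> EArr X L (EArr X L ?e) \<cdot> EArr X L h"
      using AB h by (simp add: EArr_Comp)
    also have "?b \<cdot> EArr X L ?b = ?b \<cdot> EMult L (fst B)"
      using B by (simp add: linear_space_iff)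
    also have "(?b \<cdot> EMult L (fst B)) \<cdot> EArr X L (EArr X L ?e) \<cdot> EArr X L h =
        ?b \<cdot> (EMult L (fst B) \<cdot> EArr X L (EArr X L ?e)) \<cdot> EArr X L h"
      using AB h by simp
    also have "EMult L (fst B) \<cdot> EArr X L (EArr X L ?e) = EArr X L ?e \<cdot> EMult L (?P \<boxtimes> ?a)"
      using EMult_EArr[of ?e] AB by simp
    finally show ?thesis
      using AB h by simp
  qed
  have "?f \<cdot> (Id X (EObj L ?P) \<boxdot> snd A) = ?b \<cdot> EArr X L (?e \<cdot> (Id X ?P \<boxdot> snd A)) \<cdot>
      lstrength X L ?P (EObj L ?a)"
    using AB lstrength_natural_right[of ?P "snd A"] by (simp add: EArr_Comp)
  also have "\<dots> = (?b \<cdot> EArr X L (?b \<cdot> EArr X L ?e \<cdot> rstrength X L ?P ?a)) \<cdot>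
      lstrength X L ?P (EObj L ?a)"
    unfolding em_eval_linear_right[OF A B', unfolded linear_right_def] using AB by simp
  \<comment> \<open>With the right strength for \<open>h\<close>, the expression is one side of the
    commutative law; \<open>mtens\<close> then unfolds to the other order of the strengths, the form
    from which linearity of \<open>?f\<close> is read off.\<close>
  also have "\<dots> = ?b \<cdot> EArr X L ?e \<cdot> mtens X L ?P ?a"
    using AB by (simp add: ext commutative)
  also have "\<dots> = (?b \<cdot> EArr X L ?e \<cdot> EMult L (?P \<boxtimes> ?a) \<cdot> EArr X L (lstrength X L ?P ?a)) \<cdot>
      rstrength X L (EObj L ?P) ?a"
    using AB by (simp add: mtens_def)
  also have "\<dots> = ?b \<cdot> EArr X L ?f \<cdot> rstrength X L (EObj L ?P) ?a"
    using AB ext[of "lstrength X L ?P ?a"] by (simp flip: Comp_assoc')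
  finally have "linear_right A B (EObj L ?P) ?f"
    by (simp add: linear_right_def)
  then have "\<exists>!c. c \<in> hom X (EObj L ?P) ?P \<and> ?e \<cdot> (c \<boxdot> Id X ?a) = ?f"
    using AB by (intro em_eval_universal) auto
  note c = theI'[OF this]
  moreover have "snd (lin_hom X L A B) =
      (THE c. c \<in> hom X (EObj L ?P) ?P \<and> ?e \<cdot> (c \<boxdot> Id X ?a) = ?f)"
    by (simp add: lin_hom_def Let_def)
  ultimately show "functor_algebra (lin_hom X L A B)"
    and "linear_left (lin_hom X L A B) B (fst A) (em_eval X L A B)"
    using AB by (simp_all add: functor_algebra_def linear_left_def)
qed

section \<open>Double dualization\<close>

lemma free_alg_linear_space [simp]:
  "Z \<in> Obj X \<Longrightarrow> linear_space X L (free_alg (ordinary X L) Z)"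
  unfolding linear_space_iff
  by (simp add: functor_algebra_def free_alg_def ordinary_def in_hom_iff EMult_EUnit EMult_EMult)

lemma ground_linear_space [simp]: "linear_space X L (ground X L)"
  by (simp add: ground_def)

lemma dual_functor_algebra [simp]: "functor_algebra E \<Longrightarrow> functor_algebra (dual X L E)"
  unfolding dual_def by (rule lin_hom_structure(1)) auto

text \<open>Evaluation is linear in its first variable by the structure put on the dual; the
  symmetry makes this linearity in the second variable, so the universal property supplies the
  arrow. Its description through \<open>em_hom\<close> is equivalent, by transposition, to the
  equation between evaluations.\<close>

lemma dd_unit_props:
  assumes E: "functor_algebra E"
  shows "und (dd_unit X L E) \<in> hom X (fst E) (fst (dual X L (dual X L E)))"
    and "em_eval X L (dual X L E) (ground X L) \<cdot>
        (und (dd_unit X L E) \<boxdot> Id X (fst (dual X L E))) =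
      em_eval X L E (ground X L) \<cdot> symm X (fst E) (fst (dual X L E))"
proof -
  let ?R = "ground X L" and ?E' = "dual X L E" and ?E = "fst E"
  let ?e = "em_eval X L E ?R"
  let ?f = "?e \<cdot> symm X ?E (fst ?E')"
  have R: "functor_algebra ?R" and E': "functor_algebra ?E'"
    using E by simp_all
  have e: "?e \<in> Arr X" "Dom X ?e = fst ?E' \<boxtimes> ?E" "Cod X ?e = fst ?R"
    using E R by (simp_all add: dual_def)
  note simps = e E R E'
  have "?f \<cdot> (Id X ?E \<boxdot> snd ?E') = (?e \<cdot> (snd ?E' \<boxdot> Id X ?E)) \<cdot> symm X ?E (EObj L (fst ?E'))"
    using simps symm_natural'[of "Id X ?E" "snd ?E'"] by simp
  also have "\<dots> = (snd ?R \<cdot> EArr X L ?e \<cdot> lstrength X L (fst ?E') ?E) \<cdot>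
      symm X ?E (EObj L (fst ?E'))"
    using lin_hom_structure(2)[OF E ground_linear_space] by (simp add: linear_left_def dual_def)
  also have "\<dots> = snd ?R \<cdot> EArr X L ?e \<cdot>
      (lstrength X L (fst ?E') ?E \<cdot> symm X ?E (EObj L (fst ?E')))"
    using simps by simp
  also have "\<dots> = snd ?R \<cdot> EArr X L ?f \<cdot> rstrength X L ?E (fst ?E')"
    using simps by (simp add: lstrength_symm EArr_Comp)
  finally have "linear_right ?E' ?R ?E ?f"
    by (simp add: linear_right_def)
  then have "\<exists>!d. d \<in> hom X ?E (fst (lin_hom X L ?E' ?R)) \<and>
      em_eval X L ?E' ?R \<cdot> (d \<boxdot> Id X (fst ?E')) = ?f"
    using simps by (intro em_eval_universal) auto
  moreover have "em_hom X L ?E' ?R \<cdot> d = transp X ?E (fst ?E') (fst ?R) ?f \<longleftrightarrow>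
      em_eval X L ?E' ?R \<cdot> (d \<boxdot> Id X (fst ?E')) = ?f"
    if "d \<in> hom X ?E (fst (lin_hom X L ?E' ?R))" for d
    using that simps em_hom_Comp_iff[OF E' R, of d "transp X ?E (fst ?E') (fst ?R) ?f"]
    by (simp add: in_hom_iff)
  ultimately have "\<exists>!d. d \<in> hom X ?E (fst (lin_hom X L ?E' ?R)) \<and>
      em_hom X L ?E' ?R \<cdot> d = transp X ?E (fst ?E') (fst ?R) ?f" (is "\<exists>!d. ?D d")
    by metis
  from theI'[OF this] have D: "?D (und (dd_unit X L E))"
    by (simp add: dd_unit_def und_def Let_def dual_def)
  then show "und (dd_unit X L E) \<in> hom X ?E (fst (dual X L ?E'))"
    by (simp add: dual_def)
  show "em_eval X L ?E' ?R \<cdot> (und (dd_unit X L E) \<boxdot> Id X (fst ?E')) = ?f"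
    using D simps em_hom_Comp_iff[OF E' R, of "und (dd_unit X L E)"
        "transp X ?E (fst ?E') (fst ?R) ?f"]
    by (simp add: in_hom_iff)
qed

text \<open>This is the triangle identity: the dual of \<open>dd_unit X L U\<close> splits \<open>dd_unit X L (dual X L U)\<close>.\<close>

lemma dd_unit_dual_cancel:
  assumes U: "functor_algebra U"
    and f: "f \<in> Arr X" "Cod X f = fst (dual X L U)"
    and g: "g \<in> Arr X" "Cod X g = fst (dual X L U)" "Dom X f = Dom X g"
    and eq: "und (dd_unit X L (dual X L U)) \<cdot> f = und (dd_unit X L (dual X L U)) \<cdot> g"
  shows "f = g"
proof -
  let ?R = "ground X L" and ?W = "dual X L U" and ?Z = "Dom X g"
  let ?W' = "dual X L ?W"
  let ?d = "und (dd_unit X L ?W)" and ?c = "und (dd_unit X L U)"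
  let ?e = "em_eval X L U ?R" and ?e' = "em_eval X L ?W ?R" and ?e'' = "em_eval X L ?W' ?R"
  have R: "functor_algebra ?R" and W: "functor_algebra ?W" and W': "functor_algebra ?W'"
    using U by simp_all
  have d: "?d \<in> Arr X" "Dom X ?d = fst ?W" "Cod X ?d = fst (dual X L ?W')"
    using dd_unit_props(1)[OF W] by (auto simp: in_hom_iff)
  have c: "?c \<in> Arr X" "Dom X ?c = fst U" "Cod X ?c = fst ?W'"
    using dd_unit_props(1)[OF U] by (auto simp: in_hom_iff)
  have e: "?e \<in> Arr X" "Dom X ?e = fst ?W \<boxtimes> fst U" "Cod X ?e = fst ?R"
    using U R by (simp_all add: dual_def)
  have e': "?e' \<in> Arr X" "Dom X ?e' = fst ?W' \<boxtimes> fst ?W" "Cod X ?e' = fst ?R"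
    using W R by (simp_all add: dual_def[of X L ?W])
  have e'': "?e'' \<in> Arr X" "Dom X ?e'' = fst (dual X L ?W') \<boxtimes> fst ?W'" "Cod X ?e'' = fst ?R"
    using W' R by (simp_all add: dual_def[of X L ?W'])
  note simps = U R W W' d c e e' e''
  \<comment> \<open>Evaluating \<open>?d \<cdot> h\<close> along \<open>?c\<close> gives back the
    evaluation of \<open>h\<close>: the triangle identity, written with evaluations instead of the
    dual arrow of \<open>?c\<close>.\<close>
  have key: "?e \<cdot> (h \<boxdot> Id X (fst U)) = (?e'' \<cdot> ((?d \<cdot> h) \<boxdot> Id X (fst ?W'))) \<cdot> (Id X ?Z \<boxdot> ?c)"
    if h: "h \<in> Arr X" "Cod X h = fst ?W" "Dom X h = ?Z" for h
  proof -
    have "(?e'' \<cdot> ((?d \<cdot> h) \<boxdot> Id X (fst ?W'))) \<cdot> (Id X ?Z \<boxdot> ?c) =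
        (?e'' \<cdot> (?d \<boxdot> Id X (fst ?W'))) \<cdot> (h \<boxdot> ?c)"
      using simps h g by simp
    also have "\<dots> = (?e' \<cdot> symm X (fst ?W) (fst ?W')) \<cdot> (h \<boxdot> ?c)"
      using dd_unit_props(2)[OF W] by simp
    also have "\<dots> = ?e' \<cdot> (?c \<boxdot> h) \<cdot> symm X ?Z (fst U)"
      using simps h g symm_natural'[of h ?c] by simp
    also have "\<dots> = (?e' \<cdot> (?c \<boxdot> Id X (fst ?W))) \<cdot> (Id X (fst U) \<boxdot> h) \<cdot> symm X ?Z (fst U)"
      using simps h g by simp
    also have "\<dots> = (?e \<cdot> symm X (fst U) (fst ?W)) \<cdot> (Id X (fst U) \<boxdot> h) \<cdot> symm X ?Z (fst U)"
      using dd_unit_props(2)[OF U] by simp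
    also have "\<dots> = ?e \<cdot> (symm X (fst U) (fst ?W) \<cdot> (Id X (fst U) \<boxdot> h)) \<cdot> symm X ?Z (fst U)"
      using simps h g by simp
    also have "symm X (fst U) (fst ?W) \<cdot> (Id X (fst U) \<boxdot> h) =
        (h \<boxdot> Id X (fst U)) \<cdot> symm X (fst U) ?Z"
      using simps h g symm_natural'[of "Id X (fst U)" h] by simp
    also have "?e \<cdot> ((h \<boxdot> Id X (fst U)) \<cdot> symm X (fst U) ?Z) \<cdot> symm X ?Z (fst U) =
        ?e \<cdot> (h \<boxdot> Id X (fst U))"
      using simps h g by (simp add: symm_symm)
    finally show ?thesis by simp
  qed
  have "?e \<cdot> (f \<boxdot> Id X (fst U)) = ?e \<cdot> (g \<boxdot> Id X (fst U))"
    using key[of f] key[of g] f g eq by simp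
  from em_eval_cancel[OF U R _ _ _ _ _ this] show ?thesis
    using f g by (simp add: dual_def)
qed

section \<open>Linear maps as points of internal homs\<close>

definition linear :: "('o, 'm) alg \<Rightarrow> ('o, 'm) alg \<Rightarrow> 'm \<Rightarrow> bool" where
  "linear A B f \<longleftrightarrow> f \<in> hom X (fst A) (fst B) \<and> f \<cdot> snd A = snd B \<cdot> EArr X L f"

lemma linear_simps:
  assumes "linear A B f"
  shows "f \<in> Arr X" "Dom X f = fst A" "Cod X f = fst B"
  using assms by (auto simp: linear_def in_hom_iff)

lemma linearD: "linear A B f \<Longrightarrow> f \<cdot> snd A = snd B \<cdot> EArr X L f"
  by (simp add: linear_def)

lemma linear_Comp:
  assumes "linear A B f" "linear B D g" "functor_algebra A" "functor_algebra B" "functor_algebra D"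
  shows "linear A D (g \<cdot> f)"
proof -
  note arrows = linear_simps[OF assms(1)] linear_simps[OF assms(2)]
  have "(g \<cdot> f) \<cdot> snd A = g \<cdot> snd B \<cdot> EArr X L f"
    using arrows assms(3-5) linearD[OF assms(1)] by simp
  also have "\<dots> = (g \<cdot> snd B) \<cdot> EArr X L f"
    using arrows assms(3-5) by simp
  also have "\<dots> = snd D \<cdot> EArr X L (g \<cdot> f)"
    unfolding linearD[OF assms(2)] using arrows assms(3-5) by (simp add: EArr_Comp)
  finally show ?thesis
    using arrows assms(3-5) by (simp add: linear_def in_hom_iff)
qed

lemma Lin_simps [simp]:
  "Dom (Lin X L) h = fst h" "Cod (Lin X L) h = snd (snd h)"
  "k \<cdot>\<^bsub>Lin X L\<^esub> h = (fst h, und k \<cdot> und h, snd (snd k))"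
  "Id (Lin X L) A = (A, Id X (fst A), A)"
  by (simp_all add: EM_def)

lemma und_triple [simp]: "und (A, f, B) = f"
  by (simp add: und_def)

lemma hom_Lin_iff:
  "h \<in> hom (Lin X L) A B \<longleftrightarrow>
    linear_space X L A \<and> linear_space X L B \<and> linear A B (und h) \<and> h = (A, und h, B)"
  by (cases h) (auto simp: hom_def EM_def linear_def ordinary_def)

text \<open>The name of \<open>f\<close> equalizes the pair defining \<open>em_hom\<close> exactly
  when \<open>f\<close> is linear; \<open>equalizes_iff\<close> restates this with the unit object
  as parameter.\<close>

lemma linear_iff_name:
  assumes "functor_algebra A" "functor_algebra B" "f \<in> hom X (fst A) (fst B)"
  shows "linear A B f \<longleftrightarrow> linear_right A B (unit X) (f \<cdot> lunit X (fst A))"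
proof -
  have f: "f \<in> Arr X" "Dom X f = fst A" "Cod X f = fst B"
    using assms(3) by (auto simp: in_hom_iff)
  have pre: "ihom_pre X (snd A) (fst B) \<cdot> name_arr X f = name_arr X (f \<cdot> snd A)"
    using assms f by (intro ihom_pre_name) auto
  have post: "(ihom_post X (EObj L (fst A)) (snd B) \<cdot> EStr L (fst A) (fst B)) \<cdot> name_arr X f =
      name_arr X (snd B \<cdot> EArr X L f)"
    using assms f ihom_post_name[of "EArr X L f" "snd B" "EObj L (fst A)"]
    by (simp add: name_arr_EArr)
  have "linear A B f \<longleftrightarrow> name_arr X (f \<cdot> snd A) = name_arr X (snd B \<cdot> EArr X L f)"
    using assms f name_arr_inject[of "f \<cdot> snd A" "snd B \<cdot> EArr X L f"] by (auto simp: linear_def)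
  also have "\<dots> \<longleftrightarrow> linear_right A B (unit X) (f \<cdot> lunit X (fst A))"
    using equalizes_iff[OF assms(1,2), of "name_arr X f"] f pre post
    by (simp add: untransp_name_arr)
  finally show ?thesis .
qed

text \<open>With \<open>element_linear\<close> this identifies linear maps with points of the
  internal hom, evaluation at a point being the map up to \<open>lunit\<close>.\<close>

lemma linear_element:
  assumes A: "functor_algebra A" and B: "functor_algebra B" and f: "linear A B f"
  obtains t where "t \<in> Arr X" "Dom X t = unit X" "Cod X t = fst (lin_hom X L A B)"
    "em_eval X L A B \<cdot> (t \<boxdot> Id X (fst A)) = f \<cdot> lunit X (fst A)"
proof -
  have "linear_right A B (unit X) (f \<cdot> lunit X (fst A))"
    using linear_iff_name[OF A B, of f] f by (simp add: linear_def)
  then have "\<exists>!t. t \<in> hom X (unit X) (fst (lin_hom X L A B)) \<and>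
      em_eval X L A B \<cdot> (t \<boxdot> Id X (fst A)) = f \<cdot> lunit X (fst A)"
    using A B linear_simps[OF f] by (intro em_eval_universal) auto
  then show ?thesis
    using that by (auto simp: in_hom_iff)
qed

lemma element_linear:
  assumes A: "functor_algebra A" and B: "functor_algebra B"
    and t: "t \<in> Arr X" "Dom X t = unit X" "Cod X t = fst (lin_hom X L A B)"
  obtains f where "linear A B f"
    "em_eval X L A B \<cdot> (t \<boxdot> Id X (fst A)) = f \<cdot> lunit X (fst A)"
proof -
  obtain f where f: "f \<in> Arr X" "Dom X f = fst A" "Cod X f = fst B"
    and name: "name_arr X f = em_hom X L A B \<cdot> t"
    by (rule name_arr_surj[of "em_hom X L A B \<cdot> t" "fst A" "fst B"]) (use A B t in auto)
  have eval: "em_eval X L A B \<cdot> (t \<boxdot> Id X (fst A)) = f \<cdot> lunit X (fst A)"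
    using em_hom_Comp_iff[OF A B, of t "name_arr X f"] t f name[symmetric]
      untransp_name_arr[of f "fst A" "fst B"] by simp
  have "linear_right A B (Dom X t) (em_eval X L A B \<cdot> (t \<boxdot> Id X (fst A)))"
    by (rule linear_right_Comp[OF A B _ _ _ _ em_eval_linear_right[OF A B]]) (use A B t in auto)
  then have "linear A B f"
    using linear_iff_name[OF A B, of f] eval t f by (simp add: in_hom_iff)
  then show ?thesis
    using that eval by blast
qed

text \<open>Precomposing evaluation with a linear map keeps it linear in the second variable, by
  naturality of the strength there. So the description in \<open>lin_hom_pre\<close> denotes, and
  its arrow is known by its effect on evaluation.\<close>

lemma lin_hom_pre_props:
  assumes h: "h \<in> hom (Lin X L) A B" and E: "functor_algebra E"
  shows "und (lin_hom_pre X L h E) \<in> hom X (fst (lin_hom X L B E)) (fst (lin_hom X L A E))"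
    and "em_eval X L A E \<cdot> (und (lin_hom_pre X L h E) \<boxdot> Id X (fst A)) =
      em_eval X L B E \<cdot> (Id X (fst (lin_hom X L B E)) \<boxdot> und h)"
proof -
  let ?P = "fst (lin_hom X L B E)" and ?Q = "fst (lin_hom X L A E)"
  let ?e = "em_eval X L B E" and ?h = "und h"
  let ?f = "?e \<cdot> (Id X ?P \<boxdot> ?h)"
  have A: "functor_algebra A" and B: "functor_algebra B" and lin: "linear A B ?h"
    and h_eq: "h = (A, ?h, B)"
    using h by (simp_all add: hom_Lin_iff)
  note simps = A B E linear_simps[OF lin]
  have "?f \<cdot> (Id X ?P \<boxdot> snd A) = (?e \<cdot> (Id X ?P \<boxdot> snd B)) \<cdot> (Id X ?P \<boxdot> EArr X L ?h)"
    using simps linearD[OF lin] by simp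
  also have "\<dots> = snd E \<cdot> EArr X L ?e \<cdot> rstrength X L ?P (fst B) \<cdot> (Id X ?P \<boxdot> EArr X L ?h)"
    unfolding em_eval_linear_right[OF B E, unfolded linear_right_def] using simps by simp
  also have "\<dots> = snd E \<cdot> EArr X L ?f \<cdot> rstrength X L ?P (fst A)"
    using simps rstrength_natural_right[of ?P ?h] by (simp add: EArr_Comp)
  finally have "linear_right A E ?P ?f"
    by (simp add: linear_right_def)
  then have "\<exists>!v. v \<in> hom X ?P ?Q \<and> em_eval X L A E \<cdot> (v \<boxdot> Id X (fst A)) = ?f"
    using simps by (intro em_eval_universal) auto
  moreover let ?g = "ihom_pre X ?h (fst E) \<cdot> em_hom X L B E"
  have "em_hom X L A E \<cdot> v = ?g \<longleftrightarrow> em_eval X L A E \<cdot> (v \<boxdot> Id X (fst A)) = ?f"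
    if "v \<in> hom X ?P ?Q" for v
  proof -
    have "untransp X (fst A) (fst E) ?g = ?f"
      using simps by (simp add: untransp_ihom_pre em_eval_def)
    then show ?thesis
      using that simps em_hom_Comp_iff[OF A E, of v ?g] by (simp add: in_hom_iff)
  qed
  ultimately have "\<exists>!v. v \<in> hom X ?P ?Q \<and> em_hom X L A E \<cdot> v = ?g"
    and iff: "\<And>v. v \<in> hom X ?P ?Q \<Longrightarrow> em_hom X L A E \<cdot> v = ?g \<longleftrightarrow>
      em_eval X L A E \<cdot> (v \<boxdot> Id X (fst A)) = ?f"
    by metis+
  note v = theI'[OF this(1)]
  have "fst h = A" "snd (snd h) = B"
    using arg_cong[OF h_eq, of fst] arg_cong[OF h_eq, of "snd \<circ> snd"] by simp_all
  then have "und (lin_hom_pre X L h E) =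
      (THE v. v \<in> hom X ?P ?Q \<and> em_hom X L A E \<cdot> v = ?g)"
    by (simp add: lin_hom_pre_def Let_def)
  then show "und (lin_hom_pre X L h E) \<in> hom X ?P ?Q"
    and "em_eval X L A E \<cdot> (und (lin_hom_pre X L h E) \<boxdot> Id X (fst A)) = ?f"
    using v iff[OF conjunct1[OF v]] by simp_all
qed

text \<open>An isomorphism of internal homs acts bijectively on points, and these points are linear
  maps. This turns the enriched form of reflectivity into the ordinary extension property.\<close>

lemma linear_extension:
  assumes h: "h \<in> hom (Lin X L) A K" and B: "functor_algebra B"
    and iso: "iso_arr (Lin X L) (lin_hom_pre X L h B)" and f: "linear A B f"
  shows "\<exists>!k. linear K B k \<and> k \<cdot> und h = f"
proof -
  let ?v = "und (lin_hom_pre X L h B)"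
  let ?P = "fst (lin_hom X L K B)" and ?Q = "fst (lin_hom X L A B)"
  let ?e = "em_eval X L K B" and ?e' = "em_eval X L A B"
  have A: "functor_algebra A" and K: "functor_algebra K" and lin: "linear A K (und h)"
    and h_eq: "fst h = A" "snd (snd h) = K"
    using h by (auto simp: hom_Lin_iff) (metis fst_conv snd_conv)+
  have v: "?v \<in> Arr X" "Dom X ?v = ?P" "Cod X ?v = ?Q"
    using lin_hom_pre_props(1)[OF h B] by (auto simp: in_hom_iff)
  have "fst (lin_hom_pre X L h B) = lin_hom X L K B" "snd (snd (lin_hom_pre X L h B)) = lin_hom X L A B"
    using h_eq by (simp_all add: lin_hom_pre_def Let_def)
  moreover obtain k where
    "k \<in> hom (Lin X L) (Cod (Lin X L) (lin_hom_pre X L h B)) (Dom (Lin X L) (lin_hom_pre X L h B))"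
    "k \<cdot>\<^bsub>Lin X L\<^esub> lin_hom_pre X L h B = Id (Lin X L) (Dom (Lin X L) (lin_hom_pre X L h B))"
    "lin_hom_pre X L h B \<cdot>\<^bsub>Lin X L\<^esub> k = Id (Lin X L) (Cod (Lin X L) (lin_hom_pre X L h B))"
    using iso unfolding iso_arr_def by blast
  ultimately have k: "linear (lin_hom X L A B) (lin_hom X L K B) (und k)"
    and wv: "und k \<cdot> ?v = Id X ?P" and vw: "?v \<cdot> und k = Id X ?Q"
    by (simp_all add: hom_Lin_iff)
  define w where "w = und k"
  have w: "w \<in> Arr X" "Dom X w = ?Q" "Cod X w = ?P"
    and wv: "w \<cdot> ?v = Id X ?P" and vw: "?v \<cdot> w = Id X ?Q"
    using linear_simps[OF k] wv vw by (simp_all add: w_def)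
  note simps = A K B linear_simps[OF lin] v w
  have eval: "?e' \<cdot> ((?v \<cdot> s) \<boxdot> Id X (fst A)) = (?e \<cdot> (s \<boxdot> Id X (fst K))) \<cdot> (Id X (Dom X s) \<boxdot> und h)"
    if s: "s \<in> Arr X" "Cod X s = ?P" for s
  proof -
    have "?e' \<cdot> ((?v \<cdot> s) \<boxdot> Id X (fst A)) = (?e' \<cdot> (?v \<boxdot> Id X (fst A))) \<cdot> (s \<boxdot> Id X (fst A))"
      using simps s by simp
    also have "\<dots> = (?e \<cdot> (Id X ?P \<boxdot> und h)) \<cdot> (s \<boxdot> Id X (fst A))"
      using lin_hom_pre_props(2)[OF h B] by simp
    finally show ?thesis
      using simps s by simp
  qed
  \<comment> \<open>If the point \<open>s\<close> names \<open>k\<close>, then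
    \<open>?v \<cdot> s\<close> names the restriction of \<open>k\<close> along \<open>h\<close>.
    Here \<open>k\<close> is a linear map, no longer the inverse of the isomorphism.\<close>
  have restrict: "(k \<cdot> und h) \<cdot> lunit X (fst A) = ?e' \<cdot> ((?v \<cdot> s) \<boxdot> Id X (fst A))"
    if "linear K B k" "s \<in> Arr X" "Dom X s = unit X" "Cod X s = ?P"
      "?e \<cdot> (s \<boxdot> Id X (fst K)) = k \<cdot> lunit X (fst K)" for k s
    using that(2-5) linear_simps[OF that(1)] simps eval[of s] lunit_natural'[of "und h"] by simp
  show ?thesis
  proof (rule ex_ex1I)
    obtain t where t: "t \<in> Arr X" "Dom X t = unit X" "Cod X t = ?Q"
      and te: "?e' \<cdot> (t \<boxdot> Id X (fst A)) = f \<cdot> lunit X (fst A)"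
      using linear_element[OF A B f] by blast
    \<comment> \<open>The extension of \<open>f\<close> is the map named by the image of its point
      under the inverse \<open>w\<close>.\<close>
    have wt: "w \<cdot> t \<in> Arr X" "Dom X (w \<cdot> t) = unit X" "Cod X (w \<cdot> t) = ?P"
      using t simps by simp_all
    obtain k where k: "linear K B k" "?e \<cdot> ((w \<cdot> t) \<boxdot> Id X (fst K)) = k \<cdot> lunit X (fst K)"
      using element_linear[OF K B wt] by blast
    have "?v \<cdot> w \<cdot> t = (?v \<cdot> w) \<cdot> t"
      using t simps by (simp del: vw)
    then have "(k \<cdot> und h) \<cdot> lunit X (fst A) = f \<cdot> lunit X (fst A)"
      using restrict[OF k(1) wt k(2)] te vw t by simp
    from iso_epic[OF lunit_iso _ _ _ _ this] have "k \<cdot> und h = f"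
      using simps linear_simps[OF k(1)] linear_simps[OF f] by simp
    then show "\<exists>k. linear K B k \<and> k \<cdot> und h = f"
      using k by blast
  next
    fix k l assume "linear K B k \<and> k \<cdot> und h = f" "linear K B l \<and> l \<cdot> und h = f"
    then have kl: "linear K B k" "linear K B l" "k \<cdot> und h = f" "l \<cdot> und h = f"
      by simp_all
    obtain s where s: "s \<in> Arr X" "Dom X s = unit X" "Cod X s = ?P"
      "?e \<cdot> (s \<boxdot> Id X (fst K)) = k \<cdot> lunit X (fst K)"
      using linear_element[OF K B] kl by blast
    obtain t where t: "t \<in> Arr X" "Dom X t = unit X" "Cod X t = ?P"
      "?e \<cdot> (t \<boxdot> Id X (fst K)) = l \<cdot> lunit X (fst K)"
      using linear_element[OF K B] kl by blast
    have "?e' \<cdot> ((?v \<cdot> s) \<boxdot> Id X (fst A)) = ?e' \<cdot> ((?v \<cdot> t) \<boxdot> Id X (fst A))"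
      using restrict[of k s] restrict[of l t] kl s t by simp
    from em_eval_cancel[OF A B _ _ _ _ _ this] have "?v \<cdot> s = ?v \<cdot> t"
      using simps s t by simp
    then have "(w \<cdot> ?v) \<cdot> s = (w \<cdot> ?v) \<cdot> t"
      using simps s t by (simp del: wv)
    then have "s = t"
      using wv s t by simp
    then have "k \<cdot> lunit X (fst K) = l \<cdot> lunit X (fst K)"
      using s t by simp
    from iso_epic[OF lunit_iso _ _ _ _ this] show "k = l"
      using simps linear_simps[OF kl(1)] linear_simps[OF kl(2)] by simp
  qed
qed

text \<open>The forgetful functor preserves monomorphisms: \<open>f\<close> and \<open>g\<close>
  extend to linear maps out of the free algebra on \<open>Z\<close>, monicity in
  \<open>Lin X L\<close> applies to these, and restriction along the unit recovers \<open>f\<close>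
  and \<open>g\<close>. This permits cancellation against arrows not known to be linear, such as
  Pettis structures.\<close>

lemma separated_cancel:
  assumes sep: "separated X L E" and dd: "dd_unit X L E \<in> hom (Lin X L) E E''"
    and f: "f \<in> hom X Z (fst E)" and g: "g \<in> hom X Z (fst E)"
    and eq: "und (dd_unit X L E) \<cdot> f = und (dd_unit X L E) \<cdot> g"
  shows "f = g"
proof -
  let ?d = "und (dd_unit X L E)"
  have E: "linear_space X L E" and E'': "linear_space X L E''" and d: "linear E E'' ?d"
    and dom: "fst (dd_unit X L E) = E"
    using dd by (auto simp: hom_Lin_iff) (metis fst_conv)
  note simps = linear_space_functor_algebra[OF E] linear_space_functor_algebra[OF E''] linear_simps[OF d]
  have extend: "linear (free_alg (ordinary X L) Z) E (snd E \<cdot> EArr X L h)"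
    and d_extend: "?d \<cdot> snd E \<cdot> EArr X L h = snd E'' \<cdot> EArr X L (?d \<cdot> h)"
    and restrict: "(snd E \<cdot> EArr X L h) \<cdot> EUnit L Z = h" if "h \<in> hom X Z (fst E)" for h
  proof -
    have h: "h \<in> Arr X" "Dom X h = Z" "Cod X h = fst E" "Z \<in> Obj X"
      using that Dom_Obj[of h] by (auto simp: in_hom_iff)
    have "(snd E \<cdot> EArr X L h) \<cdot> EMult L Z = snd E \<cdot> EMult L (fst E) \<cdot> EArr X L (EArr X L h)"
      using simps h EMult_EArr[of h] by simp
    also have "\<dots> = (snd E \<cdot> EMult L (fst E)) \<cdot> EArr X L (EArr X L h)"
      using simps h by simp
    also have "\<dots> = snd E \<cdot> EArr X L (snd E \<cdot> EArr X L h)"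
      using simps h E[unfolded linear_space_iff] by (simp add: EArr_Comp)
    finally show "linear (free_alg (ordinary X L) Z) E (snd E \<cdot> EArr X L h)"
      using simps h by (simp add: linear_def free_alg_def ordinary_def in_hom_iff)
    have "?d \<cdot> snd E \<cdot> EArr X L h = (?d \<cdot> snd E) \<cdot> EArr X L h"
      using simps h by simp
    then show "?d \<cdot> snd E \<cdot> EArr X L h = snd E'' \<cdot> EArr X L (?d \<cdot> h)"
      unfolding linearD[OF d] using simps h by (simp add: EArr_Comp)
    have "(snd E \<cdot> EArr X L h) \<cdot> EUnit L Z = snd E \<cdot> EUnit L (fst E) \<cdot> h"
      using simps h EUnit_EArr[of h] by simp
    also have "\<dots> = (snd E \<cdot> EUnit L (fst E)) \<cdot> h"
      using simps h by simp
    finally show "(snd E \<cdot> EArr X L h) \<cdot> EUnit L Z = h"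
      using simps h E[unfolded linear_space_iff] by simp
  qed
  have Z: "Z \<in> Obj X"
    using f Dom_Obj[of f] by (auto simp: in_hom_iff)
  let ?F = "free_alg (ordinary X L) Z"
  have hom: "(?F, snd E \<cdot> EArr X L h, E) \<in> hom (Lin X L) ?F E" if "h \<in> hom X Z (fst E)" for h
    using extend[OF that] E Z by (simp add: hom_Lin_iff)
  have "monic (Lin X L) (dd_unit X L E)"
    using sep by (simp add: separated_def strong_mono_def)
  moreover have "dd_unit X L E \<cdot>\<^bsub>Lin X L\<^esub> (?F, snd E \<cdot> EArr X L f, E) =
      dd_unit X L E \<cdot>\<^bsub>Lin X L\<^esub> (?F, snd E \<cdot> EArr X L g, E)"
    using d_extend f g eq by simp
  ultimately have "(?F, snd E \<cdot> EArr X L f, E) = (?F, snd E \<cdot> EArr X L g, E)"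
    using hom[OF f] hom[OF g] Z dom unfolding monic_def by (metis Lin_simps(1) free_alg_linear_space)
  then have "snd E \<cdot> EArr X L f = snd E \<cdot> EArr X L g"
    by simp
  with restrict[OF f] restrict[OF g] show ?thesis
    by argo
qed

end

section \<open>Accessible distributions\<close>

locale accessible_distributions = linear_spaces X L
  for X :: "('o, 'm, 'x) smc_category_scheme" (structure)
  and L :: "('o, 'm) enriched_monad" +
  fixes r :: "('o, 'm) alg \<Rightarrow> ('o, 'm) alg_arr"
    and i :: "('o, 'm) alg \<Rightarrow> ('o, 'm) alg_arr"
  assumes reflection: "fc_reflection X L r"
    and morphism: "monad_morphism (Lin X L) (refl_monad X L r) (ddual_monad X L) i"
begin

section \<open>The reflection, its monad, and its comparison with double dualization\<close>

abbreviation K :: "('o, 'm) alg \<Rightarrow> ('o, 'm) alg" where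
  "K E \<equiv> snd (snd (r E))"

abbreviation F :: "'o \<Rightarrow> ('o, 'm) alg" where
  "F \<equiv> free_alg (ordinary X L)"

lemma r_hom: "linear_space X L E \<Longrightarrow> r E \<in> hom (Lin X L) E (K E)"
  using reflection unfolding fc_reflection_def in_hom_iff Lin_simps by blast

lemma K_linear_space [simp]: "linear_space X L E \<Longrightarrow> linear_space X L (K E)"
  using r_hom by (simp add: hom_Lin_iff)

lemma r_linear [simp]: "linear_space X L E \<Longrightarrow> linear E (K E) (und (r E))"
  using r_hom by (simp add: hom_Lin_iff)

text \<open>Spaces \<open>K B\<close> are functionally complete, so the reflection condition applies
  with them as targets. The uniqueness half serves both to evaluate the \<open>THE\<close> terms of
  \<open>refl_monad\<close> and to compare linear maps.\<close>

lemma K_extension: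
  assumes "linear_space X L E" "linear_space X L B" "linear E (K B) f"
  shows "\<exists>!k. linear (K E) (K B) k \<and> k \<cdot> und (r E) = f"
proof (rule linear_extension[OF r_hom])
  show "iso_arr (Lin X L) (lin_hom_pre X L (r E) (K B))"
    using reflection assms(1,2) unfolding fc_reflection_def Lin_simps by blast
qed (use assms in auto)

lemma K_Arr:
  assumes "h \<in> hom (Lin X L) A B"
  shows "linear (K A) (K B) (und (MArr (refl_monad X L r) h))"
    and "und (MArr (refl_monad X L r) h) \<cdot> und (r A) = und (r B) \<cdot> und h"
proof -
  have A: "linear_space X L A" and B: "linear_space X L B" and lin: "linear A B (und h)"
    and h: "fst h = A" "snd (snd h) = B"
    using assms by (auto simp: hom_Lin_iff) (metis fst_conv snd_conv)+
  have "linear A (K B) (und (r B) \<cdot> und h)"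
    using A B lin linear_Comp[OF lin r_linear[OF B]] by simp
  then obtain k where k: "linear (K A) (K B) k" "k \<cdot> und (r A) = und (r B) \<cdot> und h"
    and unique: "\<And>l. linear (K A) (K B) l \<Longrightarrow> l \<cdot> und (r A) = und (r B) \<cdot> und h \<Longrightarrow> l = k"
    using K_extension[OF A B] by metis
  have "MArr (refl_monad X L r) h = (THE k. k \<in> hom (Lin X L) (K A) (K B) \<and>
      k \<cdot>\<^bsub>Lin X L\<^esub> r A = r B \<cdot>\<^bsub>Lin X L\<^esub> h)"
    using h by (simp add: refl_monad_def Let_def)
  also have "\<dots> = (K A, k, K B)"
  proof (rule the_equality)
    show "(K A, k, K B) \<in> hom (Lin X L) (K A) (K B) \<and>
        (K A, k, K B) \<cdot>\<^bsub>Lin X L\<^esub> r A = r B \<cdot>\<^bsub>Lin X L\<^esub> h"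
      using k A B h r_hom[OF A] by (simp add: hom_Lin_iff) (metis fst_conv)
    show "l = (K A, k, K B)"
      if "l \<in> hom (Lin X L) (K A) (K B) \<and> l \<cdot>\<^bsub>Lin X L\<^esub> r A = r B \<cdot>\<^bsub>Lin X L\<^esub> h" for l
      using that unique[of "und l"] by (simp add: hom_Lin_iff)
  qed
  finally show "linear (K A) (K B) (und (MArr (refl_monad X L r) h))"
    and "und (MArr (refl_monad X L r) h) \<cdot> und (r A) = und (r B) \<cdot> und h"
    using k by simp_all
qed

lemma K_Mult:
  assumes E: "linear_space X L E"
  shows "linear (K (K E)) (K E) (und (MMult (refl_monad X L r) E))"
    and "und (MMult (refl_monad X L r) E) \<cdot> und (r (K E)) = Id X (fst (K E))"
proof -
  have "linear (K E) (K E) (Id X (fst (K E)))"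
    using E linear_space_functor_algebra[OF K_linear_space[OF E]] by (simp add: linear_def in_hom_iff)
  then obtain k where k: "linear (K (K E)) (K E) k" "k \<cdot> und (r (K E)) = Id X (fst (K E))"
    and unique: "\<And>l. linear (K (K E)) (K E) l \<Longrightarrow> l \<cdot> und (r (K E)) = Id X (fst (K E)) \<Longrightarrow> l = k"
    using K_extension[OF K_linear_space[OF E] E] by metis
  have "MMult (refl_monad X L r) E = (THE k. k \<in> hom (Lin X L) (K (K E)) (K E) \<and>
      k \<cdot>\<^bsub>Lin X L\<^esub> r (K E) = Id (Lin X L) (K E))"
    by (simp add: refl_monad_def Let_def)
  also have "\<dots> = (K (K E), k, K E)"
  proof (rule the_equality)
    show "(K (K E), k, K E) \<in> hom (Lin X L) (K (K E)) (K E) \<and>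
        (K (K E), k, K E) \<cdot>\<^bsub>Lin X L\<^esub> r (K E) = Id (Lin X L) (K E)"
      using k E r_hom[OF K_linear_space[OF E]] by (simp add: hom_Lin_iff) (metis fst_conv)
    show "l = (K (K E), k, K E)"
      if "l \<in> hom (Lin X L) (K (K E)) (K E) \<and> l \<cdot>\<^bsub>Lin X L\<^esub> r (K E) = Id (Lin X L) (K E)" for l
      using that unique[of "und l"] by (simp add: hom_Lin_iff)
  qed
  finally show "linear (K (K E)) (K E) (und (MMult (refl_monad X L r) E))"
    and "und (MMult (refl_monad X L r) E) \<cdot> und (r (K E)) = Id X (fst (K E))"
    using k by simp_all
qed

lemma F_simps [simp]: "fst (F Z) = EObj L Z" "snd (F Z) = EMult L Z"
  by (simp_all add: free_alg_def ordinary_def)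

lemma counit_hom:
  assumes E: "linear_space X L E"
  shows "counit (ordinary X L) E \<in> hom (Lin X L) (F (fst E)) E"
proof -
  have "linear (F (fst E)) E (snd E)"
    using E[unfolded linear_space_iff] by (simp add: linear_def in_hom_iff)
  then show ?thesis
    using E by (simp add: hom_Lin_iff counit_def)
qed

lemma free_arr_hom:
  assumes f: "f \<in> Arr X"
  shows "free_arr X (ordinary X L) f \<in> hom (Lin X L) (F (Dom X f)) (F (Cod X f))"
proof -
  have "linear (F (Dom X f)) (F (Cod X f)) (EArr X L f)"
    using f by (simp add: linear_def in_hom_iff EMult_EArr)
  moreover have "free_arr X (ordinary X L) f = (F (Dom X f), EArr X L f, F (Cod X f))"
    by (simp add: free_arr_def ordinary_def)
  ultimately show ?thesis
    using f by (simp add: hom_Lin_iff)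
qed

lemma i_hom:
  assumes "linear_space X L E"
  shows "i E \<in> hom (Lin X L) (K E) (dual X L (dual X L E))"
    and "i E \<cdot>\<^bsub>Lin X L\<^esub> r E = dd_unit X L E"
  using morphism assms
  by (auto simp: monad_morphism_def refl_monad_def ddual_monad_def Let_def)

text \<open>The unit law of \<open>i\<close> exhibits the double-dualization unit as a composite of
  arrows of \<open>Lin X L\<close>. Its linearity and the algebra laws of E** are thus read off from
  the typing of \<open>i\<close>, the construction of duals having given only an algebra of the
  endofunctor.\<close>

lemma dd_unit_hom:
  assumes E: "linear_space X L E"
  shows "dd_unit X L E \<in> hom (Lin X L) E (dual X L (dual X L E))"
    and "und (i E) \<cdot> und (r E) = und (dd_unit X L E)"
proof -
  let ?E'' = "dual X L (dual X L E)"
  have i: "linear_space X L ?E''" "linear (K E) ?E'' (und (i E))" "i E = (K E, und (i E), ?E'')"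
    using i_hom(1)[OF E] by (simp_all add: hom_Lin_iff)
  have "r E = (E, und (r E), K E)"
    using r_hom[OF E] by (simp add: hom_Lin_iff)
  then have dd: "dd_unit X L E = (E, und (i E) \<cdot> und (r E), ?E'')"
    using i_hom(2)[OF E] i(3) by (metis Lin_simps(3) fst_conv snd_conv)
  moreover have "linear E ?E'' (und (i E) \<cdot> und (r E))"
    using linear_Comp[OF r_linear[OF E] i(2)] i(1) E by simp
  ultimately show "dd_unit X L E \<in> hom (Lin X L) E ?E''"
    using E i(1) by (simp add: hom_Lin_iff)
  show "und (i E) \<cdot> und (r E) = und (dd_unit X L E)"
    using dd by simp
qed

text \<open>The associativity law equates two arrows out of the twice iterated distribution object;
  restricting it along the reflection unit of the free algebra on \<open>fst (K (F x))\<close>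
  leaves exactly linearity. \<open>linear\<close> asks no algebra laws of its codomain, so nothing
  is presupposed about the underlying space.\<close>

lemma acc_algebra_linear:
  assumes A: "is_algebra X (acc_monad X L r) (x, a)"
  shows "linear (K (F x)) (underlying_space X L r (x, a)) a"
proof -
  let ?T = "ordinary X L"
  have x: "x \<in> Obj X" and Fx: "linear_space X L (F x)"
    using A by (simp_all add: is_algebra_def)
  let ?K = "K (F x)"
  let ?D = "fst ?K"
  let ?M = "MArr (refl_monad X L r)"
  have a: "a \<in> Arr X" "Dom X a = ?D" "Cod X a = x"
    using A by (auto simp: is_algebra_def acc_monad_def refl_monad_def Let_def in_hom_iff)
  have K: "linear_space X L ?K"
    using Fx by simp
  have FD: "linear_space X L (F ?D)"
    using K by simp
  let ?m = "und (MMult (refl_monad X L r) (F x))"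
  let ?e = "und (?M (counit ?T ?K))" and ?k = "und (?M (free_arr X ?T a))"
  have mult: "a \<cdot> ?m \<cdot> ?e = a \<cdot> ?k"
    using A by (simp add: is_algebra_def acc_monad_def refl_monad_def Let_def)
  have m: "linear (K ?K) ?K ?m" "?m \<cdot> und (r ?K) = Id X ?D"
    using K_Mult[OF Fx] by simp_all
  have e: "linear (K (F ?D)) (K ?K) ?e" "?e \<cdot> und (r (F ?D)) = und (r ?K) \<cdot> snd ?K"
    using K_Arr[OF counit_hom[OF K]] by (simp_all add: counit_def)
  have k: "linear (K (F ?D)) ?K ?k" "?k \<cdot> und (r (F ?D)) = und (r (F x)) \<cdot> EArr X L a"
    using K_Arr[OF free_arr_hom[OF a(1)]] a by (simp_all add: free_arr_def ordinary_def)
  note simps = a linear_simps[OF m(1)] linear_simps[OF e(1)] linear_simps[OF k(1)]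
    linear_simps[OF r_linear[OF Fx]] linear_simps[OF r_linear[OF K]]
    linear_simps[OF r_linear[OF FD]] x
    linear_space_functor_algebra[OF K]
  have "(a \<cdot> und (r (F x))) \<cdot> EArr X L a = a \<cdot> und (r (F x)) \<cdot> EArr X L a"
    using simps by simp
  also have "\<dots> = (a \<cdot> ?k) \<cdot> und (r (F ?D))"
    unfolding k(2)[symmetric] using simps by simp
  also have "\<dots> = a \<cdot> ?m \<cdot> ?e \<cdot> und (r (F ?D))"
    unfolding mult[symmetric] using simps by simp
  also have "\<dots> = a \<cdot> (?m \<cdot> und (r ?K)) \<cdot> snd ?K"
    unfolding e(2) using simps by simp
  also have "\<dots> = a \<cdot> snd ?K"
    unfolding m(2) using simps by simp
  finally show ?thesis
    using a by (simp add: linear_def underlying_space_def refl_monad_def Let_def in_hom_iff)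
qed

text \<open>Here \<open>a\<close> may be any linear extension of the counit; for an underlying
  space, \<open>restrict\<close> is the definition of its structure.\<close>

lemma acc_xi_eq:
  assumes E: "linear_space X L E" and a: "linear (K (F (fst E))) E a"
    and restrict: "a \<cdot> und (r (F (fst E))) = snd E"
  shows "und (dd_unit X L E) \<cdot> a = acc_xi X L r i E"
proof -
  let ?E' = "dual X L E"
  let ?E'' = "dual X L ?E'" and ?d = "und (dd_unit X L E)"
  let ?F = "F (fst E)" and ?k = "und (MArr (refl_monad X L r) (counit (ordinary X L) E))"
  have d: "linear E ?E'' ?d" and E'': "linear_space X L ?E''"
    using dd_unit_hom(1)[OF E] by (simp_all add: hom_Lin_iff)
  have i: "linear (K E) ?E'' (und (i E))"
    using i_hom(1)[OF E] by (simp add: hom_Lin_iff)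
  have i'': "linear (K ?E'') (dual X L (dual X L ?E'')) (und (i ?E''))"
    using i_hom(1)[OF E''] by (simp add: hom_Lin_iff)
  have F: "linear_space X L ?F"
    using E by simp
  have k: "linear (K ?F) (K E) ?k" "?k \<cdot> und (r ?F) = und (r E) \<cdot> snd E"
    using K_Arr[OF counit_hom[OF E]] by (simp_all add: counit_def)
  note lin = linear_simps[OF d] linear_simps[OF i] linear_simps[OF i''] linear_simps[OF k(1)]
    linear_simps[OF a] linear_simps[OF r_linear[OF E]] linear_simps[OF r_linear[OF E'']]
    linear_simps[OF r_linear[OF F]] K_linear_space[OF E''] K_linear_space[OF F] K_linear_space[OF E] E E'' F
  let ?f = "?d \<cdot> a" and ?g = "und (i E) \<cdot> ?k" and ?r = "und (r ?E'')"
  have f: "linear (K ?F) ?E'' ?f" and g: "linear (K ?F) ?E'' ?g"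
    using linear_Comp[OF a d] linear_Comp[OF k(1) i] lin by simp_all
  note snd_E = functor_algebra_simps[OF linear_space_functor_algebra[OF E]]
  have "?f \<cdot> und (r ?F) = ?d \<cdot> snd E"
    using lin restrict by simp
  also have "\<dots> = (und (i E) \<cdot> und (r E)) \<cdot> snd E"
    using dd_unit_hom(2)[OF E] by simp
  also have "\<dots> = ?g \<cdot> und (r ?F)"
    using lin snd_E k(2) by simp
  finally have agree: "?f \<cdot> und (r ?F) = ?g \<cdot> und (r ?F)" .
  \<comment> \<open>\<open>K_extension\<close> gives uniqueness only into spaces of the form
    \<open>K B\<close>, so both maps are composed with the reflection unit of E** before they are
    compared.\<close>
  have rf: "linear (K ?F) (K ?E'') (?r \<cdot> ?f)" and rg: "linear (K ?F) (K ?E'') (?r \<cdot> ?g)"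
    using linear_Comp[OF f r_linear[OF E'']] linear_Comp[OF g r_linear[OF E'']] lin by simp_all
  have "(?r \<cdot> ?f) \<cdot> und (r ?F) = ?r \<cdot> ?f \<cdot> und (r ?F)" "(?r \<cdot> ?g) \<cdot> und (r ?F) = ?r \<cdot> ?g \<cdot> und (r ?F)"
    using Comp_assoc'[of "und (r ?F)" ?f ?r] Comp_assoc'[of "und (r ?F)" ?g ?r]
      linear_simps[OF f] linear_simps[OF g] lin by simp_all
  then have "(?r \<cdot> ?f) \<cdot> und (r ?F) = (?r \<cdot> ?g) \<cdot> und (r ?F)"
    using agree by simp
  moreover have "linear ?F (K ?E'') ((?r \<cdot> ?f) \<cdot> und (r ?F))"
    using linear_Comp[OF r_linear[OF F] rf] lin by simp
  ultimately have "?r \<cdot> ?f = ?r \<cdot> ?g"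
    using K_extension[OF F E''] rf rg by metis
  \<comment> \<open>\<open>i\<close> at E** turns this reflection unit into the double-dualization
    unit, which is cancellable because E** is the dual of \<open>?E'\<close>.\<close>
  then have "(und (i ?E'') \<cdot> ?r) \<cdot> ?f = (und (i ?E'') \<cdot> ?r) \<cdot> ?g"
    using Comp_assoc'[of ?f ?r "und (i ?E'')"] Comp_assoc'[of ?g ?r "und (i ?E'')"]
      linear_simps[OF f] linear_simps[OF g] lin by simp
  then have "und (dd_unit X L ?E'') \<cdot> ?f = und (dd_unit X L ?E'') \<cdot> ?g"
    using dd_unit_hom(2)[OF E''] by simp
  from dd_unit_dual_cancel[OF _ _ _ _ _ _ this] have "?f = ?g"
    using linear_simps[OF f] linear_simps[OF g] E by simp
  then show ?thesis
    by (simp add: acc_xi_def)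
qed

section \<open>Pettis structures and the characterization\<close>

lemma pettis_structure_unique:
  assumes "separated X L E" "is_pettis_structure X L r i E a" "is_pettis_structure X L r i E b"
  shows "a = b"
  using assms separated_cancel[OF assms(1) dd_unit_hom(1)]
  by (auto simp: is_pettis_structure_def separated_def)

text \<open>Composed with \<open>?d\<close>, both sides become \<open>?d \<cdot> snd E\<close>:
  naturality of the reflection at the counit and the unit law of \<open>i\<close> compute the
  restriction of \<open>acc_xi\<close>. The cancellation takes place in X, since \<open>a\<close> is
  a bare arrow.\<close>

lemma pettis_structure_restrict:
  assumes sep: "separated X L E" and a: "is_pettis_structure X L r i E a"
  shows "a \<cdot> und (r (F (fst E))) = snd E"
proof -
  let ?d = "und (dd_unit X L E)" and ?F = "F (fst E)"
  let ?k = "und (MArr (refl_monad X L r) (counit (ordinary X L) E))"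
  have E: "linear_space X L E"
    using sep by (simp add: separated_def)
  have F: "linear_space X L ?F"
    using E by simp
  have d: "linear E (dual X L (dual X L E)) ?d" and i: "linear (K E) (dual X L (dual X L E)) (und (i E))"
    using dd_unit_hom(1)[OF E] i_hom(1)[OF E] by (simp_all add: hom_Lin_iff)
  have a': "a \<in> Arr X" "Dom X a = fst (K ?F)" "Cod X a = fst E" "?d \<cdot> a = und (i E) \<cdot> ?k"
    using a by (auto simp: is_pettis_structure_def acc_monad_def refl_monad_def acc_xi_def
        Let_def in_hom_iff)
  have k: "linear (K ?F) (K E) ?k" "?k \<cdot> und (r ?F) = und (r E) \<cdot> snd E"
    using K_Arr[OF counit_hom[OF E]] by (simp_all add: counit_def)
  note simps = a'(1-3) linear_simps[OF d] linear_simps[OF i] linear_simps[OF k(1)]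
    linear_simps[OF r_linear[OF E]] linear_simps[OF r_linear[OF F]]
    functor_algebra_simps[OF linear_space_functor_algebra[OF E]]
  have "?d \<cdot> a \<cdot> und (r ?F) = (?d \<cdot> a) \<cdot> und (r ?F)"
    using simps by simp
  also have "\<dots> = und (i E) \<cdot> und (r E) \<cdot> snd E"
    unfolding a'(4) using simps k(2) by simp
  also have "\<dots> = (und (i E) \<cdot> und (r E)) \<cdot> snd E"
    using simps by simp
  finally have "?d \<cdot> a \<cdot> und (r ?F) = ?d \<cdot> snd E"
    unfolding dd_unit_hom(2)[OF E] .
  from separated_cancel[OF sep dd_unit_hom(1)[OF E] _ _ this, of "EObj L (fst E)"]
  show ?thesis
    using simps by (simp add: in_hom_iff)
qed

lemma pettis_iff_separated:
  assumes A: "is_algebra X (acc_monad X L r) A"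
  shows "(pettis_algebra X L r i A \<longleftrightarrow> separated X L (underlying_space X L r A)) \<and>
    (separated X L (underlying_space X L r A) \<longrightarrow>
      pettis_space X L r i (underlying_space X L r A))"
proof -
  let ?E = "underlying_space X L r A"
  have fst_E: "fst ?E = fst A" and snd_E: "snd ?E = snd A \<cdot> und (r (F (fst A)))"
    by (simp_all add: underlying_space_def refl_monad_def Let_def)
  \<comment> \<open>Uniqueness lets any known structure replace the \<open>THE\<close> in
    \<open>pettis_algebra\<close>, both for a given \<open>E\<close> and for the underlying space
    \<open>?E\<close>.\<close>
  have the_structure: "(THE a. is_pettis_structure X L r i E a) = b"
    if "separated X L E" "is_pettis_structure X L r i E b" for E b
    using that pettis_structure_unique by (intro the_equality) auto
  have pettis: "is_pettis_structure X L r i ?E (snd A)" if sep: "separated X L ?E"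
  proof -
    \<comment> \<open>\<open>separated\<close> includes being a linear space, which supplies the
      algebra laws of \<open>?E\<close>.\<close>
    have E: "linear_space X L ?E"
      using sep by (simp add: separated_def)
    have "linear (K (F (fst ?E))) ?E (snd A)"
      using acc_algebra_linear[of "fst A" "snd A"] A fst_E by simp
    then have "und (dd_unit X L ?E) \<cdot> snd A = acc_xi X L r i ?E"
      using E by (intro acc_xi_eq) (auto simp: fst_E snd_E)
    then show ?thesis
      using A by (simp add: is_pettis_structure_def is_algebra_def fst_E)
  qed
  have "separated X L ?E" if "pettis_algebra X L r i A"
  proof -
    obtain E where E: "pettis_space X L r i E" "A = (fst E, THE a. is_pettis_structure X L r i E a)"
      using \<open>pettis_algebra X L r i A\<close> by (auto simp: pettis_algebra_def)
    then obtain a where sep: "separated X L E" and a: "is_pettis_structure X L r i E a"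
      by (auto simp: pettis_space_def)
    \<comment> \<open>An equality, not merely an isomorphism: the carriers agree, and
      \<open>pettis_structure_restrict\<close> identifies the structures.\<close>
    have "?E = E"
      using E(2) the_structure[OF sep a] pettis_structure_restrict[OF sep a] fst_E snd_E
      by (simp add: prod_eq_iff)
    then show ?thesis
      using sep by simp
  qed
  moreover have "pettis_space X L r i ?E" if "separated X L ?E"
    using that pettis by (auto simp: pettis_space_def)
  moreover have "pettis_algebra X L r i A" if "separated X L ?E"
  proof -
    have "A = (fst ?E, THE a. is_pettis_structure X L r i ?E a)"
      using the_structure[OF that pettis[OF that]] fst_E by (simp add: prod_eq_iff)
    moreover have "pettis_space X L r i ?E"
      using that pettis[OF that] by (auto simp: pettis_space_def)
    ultimately show ?thesis
      using A unfolding pettis_algebra_def by blast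
  qed
  ultimately show ?thesis by blast
qed

end

theorem proposition8p10p23:
  fixes X :: "('o, 'm) smc_category"
    and L :: "('o, 'm) enriched_monad"
    and dtil :: "('o, 'm) alg \<Rightarrow> ('o, 'm) alg_arr"
    and i :: "('o, 'm) alg \<Rightarrow> ('o, 'm) alg_arr"
    and A :: "('o, 'm) alg"
  assumes "closed_symmetric_monoidal_category X"
    and "finitely_well_complete X"
    and "commutative_monad X L"
    and "has_tensor_products X L"
    and "fc_reflection X L dtil"
    and "monad_morphism (Lin X L) (refl_monad X L dtil) (ddual_monad X L) i"
    and "is_algebra X (acc_monad X L dtil) A"
  shows "(pettis_algebra X L dtil i A \<longleftrightarrow> separated X L (underlying_space X L dtil A)) \<and>
         (separated X L (underlying_space X L dtil A) \<longrightarrow>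
            pettis_space X L dtil i (underlying_space X L dtil A))"
proof -
  interpret commutative_monad X L
    by fact
  interpret accessible_distributions X L dtil i
    by unfold_locales (use assms in \<open>auto simp: finitely_well_complete_def\<close>)
  show ?thesis
    by (rule pettis_iff_separated) fact
qed

end
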